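(* Let $r\ge 3$ and $s\ge t\ge 1$. Let $\lambda=(\lambda_1,\ldots,\lambda_r)$ be a composition where $(\lambda_1,\lambda_2)$ is a permutation of $(s,t)$ and $\lambda_i=1$ if $i>2$. (i) If $(\lambda_1,\lambda_2)=(s,t)$, then $\mathcal E^{(\lambda)}=\mathcal E_s^{(\lambda)}=\{V(\lambda)\}$, where $V(\lambda)=\{(i,j) : 1\le i\le r,\ 1\le j\le\lambda_i\}$. (ii) If $(\lambda_1,\lambda_2)=(t,s)$, then $\mathcal E^{(\lambda)}=\{D_{t,s,u} : 1\le u\le s-t+1\}$, where $$D_{t,s,u}=\{(1,u)\}\cup\{(1,i) : s-t+2\le i\le s\}\cup\{(2,i) : 1\le i\le s\}\cup\{(i,u) : 3\le i\le r\}.$$ Hence $\mathcal E^{(\lambda)}=\mathcal E_s^{(\lambda)}$. Moreover, $|\mathcal E^{(\lambda)}|=s-t+1$.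
   Context: A composition $\lambda=(\lambda_1,\ldots,\lambda_r)$ of $n$ is a finite sequence of positive integers with sum $n$. $S_n$ acts on the right on $\{1,\ldots,n\}$ (products are composed left to right), with Coxeter generators $S=\{s_1,\ldots,s_{n-1}\}$, $s_i=(i,i+1)$, and Coxeter length $l$. An element $x$ is a prefix of $y$ if $y$ has a reduced expression beginning with a reduced expression for $x$ (equivalently $l(y)=l(x)+l(x^{-1}y)$). For a composition $\lambda$ of $n$ let $J(\lambda)=S\setminus\{s_{\lambda_1},s_{\lambda_1+\lambda_2},\ldots,s_{\lambda_1+\cdots+\lambda_{r-1}}\}$, let $W_{J(\lambda)}=\langle J(\lambda)\rangle$, let $w_{J(\lambda)}$ be its longest element, and let $\mathfrak{X}_{J(\lambda)}$ be the set of minimum length representatives of the right cosets $W_{J(\lambda)}w$. $\sim_R$ is the Kazhdan-Lusztig right cell equivalence on $S_n$; explicitly, $w\sim_R w'$ if and only if the Robinson-Schensted recording tableaux agree, $\mathcal Q(w)=\mathcal Q(w')$, where $w$ is inserted via its row-form $[1w,\ldots,nw]$. $Z(\lambda)=\{e\in\mathfrak{X}_{J(\lambda)} : w_{J(\lambda)}e\sim_R w_{J(\lambda)}\}$ and $Y(\lambda)=\{x\in Z(\lambda) : x\text{ is not a prefix of any other }y\in Z(\lambda)\}$. A diagram $D$ is a non-empty finite subset of $\mathbb Z^2$ whose nodes $(a,b)$ have row index $a$ and column index $b$ (rows top to bottom, columns left to right), with no empty rows or columns, and both rows and columns indexed consecutively from $1$. $\mathcal D^{(\lambda)}$ is the set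 of diagrams whose $k$-th row has exactly $\lambda_k$ nodes for each $k$ (and having exactly $r$ rows). For a diagram $D$ of size $n$, $t^D$ and $t_D$ are the bijections $D\to\{1,\ldots,n\}$ filling the nodes of $D$ with $1,\ldots,n$ by rows and by columns respectively, and $w_D\in S_n$ is defined by $t^Dw_D=t_D$, where $tw$ is obtained from $t$ by replacing each entry $i$ by $iw$. For $d\in\mathfrak{X}_{J(\lambda)}$, $D(d,\lambda)$ is the unique diagram with the minimum number of columns among all $E\in\mathcal D^{(\lambda)}$ with $w_E=d$ (such diagrams exist, and the minimal one is known to be unique). A diagram is special if it is obtained from a Young diagram by permuting rows and columns. $\mathcal E^{(\lambda)}=\{D(y,\lambda) : y\in Y(\lambda)\}$ and $\mathcal E_s^{(\lambda)}=\{D\in\mathcal E^{(\lambda)} : D\text{ is special}\}$. *)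

theory Defs
  imports "HOL-Algebra.Generated_Groups" "HOL-Combinatorics.Permutations"
begin

definition composition_of :: "nat list \<Rightarrow> nat \<Rightarrow> bool" where
  "composition_of lam n \<longleftrightarrow> (\<forall>a\<in>set lam. 0 < a) \<and> sum_list lam = n"

definition partition_of :: "nat list \<Rightarrow> nat \<Rightarrow> bool" where
  "partition_of mu n \<longleftrightarrow> composition_of mu n \<and> sorted_wrt (\<ge>) mu"

section \<open>The symmetric group as a Coxeter group\<close>

text \<open>
  Permutations act on the right, so the image \<open>iw\<close> is written \<open>w i\<close>, and a product \<open>xy\<close> means
  \<open>x\<close> first, then \<open>y\<close>.
\<close>

definition symg :: "nat \<Rightarrow> (nat \<Rightarrow> nat) monoid" where
  "symg n = \<lparr>carrier = {w. w permutes {1..n}}, monoid.mult = (\<lambda>x y. y \<circ> x), one = id\<rparr>"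

definition cox_gen :: "nat \<Rightarrow> nat \<Rightarrow> nat" where
  "cox_gen i = transpose i (Suc i)"

definition cox_gens :: "nat \<Rightarrow> (nat \<Rightarrow> nat) set" where
  "cox_gens n = cox_gen ` {1..<n}"

definition expression :: "nat \<Rightarrow> (nat \<Rightarrow> nat) list \<Rightarrow> (nat \<Rightarrow> nat) \<Rightarrow> bool" where
  "expression n ws w \<longleftrightarrow>
     set ws \<subseteq> cox_gens n \<and> foldr (\<lambda>x y. x \<otimes>\<^bsub>symg n\<^esub> y) ws \<one>\<^bsub>symg n\<^esub> = w"

definition cox_length :: "nat \<Rightarrow> (nat \<Rightarrow> nat) \<Rightarrow> nat" where
  "cox_length n w = (LEAST k. \<exists>ws. expression n ws w \<and> length ws = k)"

definition reduced_expression :: "nat \<Rightarrow> (nat \<Rightarrow> nat) list \<Rightarrow> (nat \<Rightarrow> nat) \<Rightarrow> bool" where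
  "reduced_expression n ws w \<longleftrightarrow> expression n ws w \<and> length ws = cox_length n w"

definition cox_prefix :: "nat \<Rightarrow> (nat \<Rightarrow> nat) \<Rightarrow> (nat \<Rightarrow> nat) \<Rightarrow> bool" where
  "cox_prefix n x y \<longleftrightarrow>
     (\<exists>us vs. reduced_expression n us x \<and> reduced_expression n (us @ vs) y)"

text \<open>In all that follows, a composition \<open>lam\<close> is a composition of \<open>n = sum_list lam\<close>.\<close>

definition J_gens :: "nat list \<Rightarrow> (nat \<Rightarrow> nat) set" where
  "J_gens lam = cox_gens (sum_list lam)
     - {cox_gen (sum_list (take k lam)) | k. 1 \<le> k \<and> k < length lam}"

definition W_J :: "nat list \<Rightarrow> (nat \<Rightarrow> nat) set" where
  "W_J lam = generate (symg (sum_list lam)) (J_gens lam)"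

definition w_J :: "nat list \<Rightarrow> nat \<Rightarrow> nat" where
  "w_J lam = (THE w. is_arg_max (cox_length (sum_list lam)) (\<lambda>w. w \<in> W_J lam) w)"

definition X_J :: "nat list \<Rightarrow> (nat \<Rightarrow> nat) set" where
  "X_J lam = {d \<in> carrier (symg (sum_list lam)).
     \<forall>x \<in> W_J lam #>\<^bsub>symg (sum_list lam)\<^esub> d.
       cox_length (sum_list lam) d \<le> cox_length (sum_list lam) x}"

section \<open>Robinson--Schensted and right cells\<close>

text \<open>A tableau is the list of its rows, from top to bottom.\<close>

fun row_insert :: "nat \<Rightarrow> nat list \<Rightarrow> nat list \<times> nat option" where
  "row_insert x [] = ([x], None)"
| "row_insert x (y # ys) =
     (if x < y then (x # ys, Some y)
      else (case row_insert x ys of (zs, b) \<Rightarrow> (y # zs, b)))"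

text \<open>
  The first argument of \<open>rs_insert\<close> is the label of the new node in the recording tableau; that
  node is added at the end of the row in which the bumping process stops.
\<close>

fun rs_insert :: "nat \<Rightarrow> nat \<Rightarrow> nat list list \<times> nat list list \<Rightarrow> nat list list \<times> nat list list"
where
  "rs_insert k x (p # P, q # Q) =
     (case row_insert x p of
        (p', None) \<Rightarrow> (p' # P, (q @ [k]) # Q)
      | (p', Some y) \<Rightarrow> (case rs_insert k y (P, Q) of (P', Q') \<Rightarrow> (p' # P', q # Q')))"
| "rs_insert k x (P, Q) = ([[x]], [[k]])"

definition recording_tableau :: "nat \<Rightarrow> (nat \<Rightarrow> nat) \<Rightarrow> nat list list" where
  "recording_tableau n w = snd (fold (\<lambda>k. rs_insert k (w k)) [1..<Suc n] ([], []))"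

text \<open>
  The Kazhdan--Lusztig right cell equivalence on the symmetric group, in its explicit
  Robinson--Schensted form.
\<close>

definition right_cell_equiv :: "nat \<Rightarrow> (nat \<Rightarrow> nat) \<Rightarrow> (nat \<Rightarrow> nat) \<Rightarrow> bool" where
  "right_cell_equiv n w w' \<longleftrightarrow> recording_tableau n w = recording_tableau n w'"

definition Z_set :: "nat list \<Rightarrow> (nat \<Rightarrow> nat) set" where
  "Z_set lam = {e \<in> X_J lam.
     right_cell_equiv (sum_list lam) (w_J lam \<otimes>\<^bsub>symg (sum_list lam)\<^esub> e) (w_J lam)}"

definition Y_set :: "nat list \<Rightarrow> (nat \<Rightarrow> nat) set" where
  "Y_set lam = {x \<in> Z_set lam. \<forall>y \<in> Z_set lam. y \<noteq> x \<longrightarrow> \<not> cox_prefix (sum_list lam) x y}"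

section \<open>Diagrams\<close>

text \<open>
  Row and column indices of a diagram start at 1, so \<open>nat \<times> nat\<close> can serve as the ambient grid
  in place of \<open>int \<times> int\<close>.
\<close>

definition diagram :: "(nat \<times> nat) set \<Rightarrow> bool" where
  "diagram D \<longleftrightarrow> finite D \<and> D \<noteq> {} \<and>
     (\<exists>r. fst ` D = {1..r}) \<and> (\<exists>c. snd ` D = {1..c})"

definition diagrams_of :: "nat list \<Rightarrow> (nat \<times> nat) set set" where
  "diagrams_of lam = {D. diagram D \<and> fst ` D = {1..length lam} \<and>
     (\<forall>k\<in>{1..length lam}. card {b. (k, b) \<in> D} = lam ! (k - 1))}"

text \<open>\<open>t_row D\<close> and \<open>t_col D\<close> number the nodes of \<open>D\<close> by rows and by columns respectively.\<close>

definition t_row :: "(nat \<times> nat) set \<Rightarrow> nat \<times> nat \<Rightarrow> nat" where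
  "t_row D = (\<lambda>(a, b). card {(a', b') \<in> D. a' < a \<or> (a' = a \<and> b' \<le> b)})"

definition t_col :: "(nat \<times> nat) set \<Rightarrow> nat \<times> nat \<Rightarrow> nat" where
  "t_col D = (\<lambda>(a, b). card {(a', b') \<in> D. b' < b \<or> (b' = b \<and> a' \<le> a)})"

definition w_diag :: "(nat \<times> nat) set \<Rightarrow> nat \<Rightarrow> nat" where
  "w_diag D = (THE w. w \<in> carrier (symg (card D)) \<and> (\<forall>x\<in>D. w (t_row D x) = t_col D x))"

definition min_diagram :: "(nat \<Rightarrow> nat) \<Rightarrow> nat list \<Rightarrow> (nat \<times> nat) set" where
  "min_diagram d lam =
     (THE D. is_arg_min (\<lambda>E. card (snd ` E)) (\<lambda>E. E \<in> diagrams_of lam \<and> w_diag E = d) D)"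

definition V_diagram :: "nat list \<Rightarrow> (nat \<times> nat) set" where
  "V_diagram lam = {(i, j). 1 \<le> i \<and> i \<le> length lam \<and> 1 \<le> j \<and> j \<le> lam ! (i - 1)}"

text \<open>\<open>V_diagram mu\<close> is the Young diagram of \<open>mu\<close> when \<open>mu\<close> is a partition.\<close>

definition special :: "(nat \<times> nat) set \<Rightarrow> bool" where
  "special D \<longleftrightarrow> diagram D \<and>
     (\<exists>mu n \<sigma> \<tau>. partition_of mu n \<and>
        \<sigma> permutes (fst ` V_diagram mu) \<and> \<tau> permutes (snd ` V_diagram mu) \<and>
        D = map_prod \<sigma> \<tau> ` V_diagram mu)"

definition E_set :: "nat list \<Rightarrow> (nat \<times> nat) set set" where
  "E_set lam = (\<lambda>y. min_diagram y lam) ` Y_set lam"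

definition E_special :: "nat list \<Rightarrow> (nat \<times> nat) set set" where
  "E_special lam = {D \<in> E_set lam. special D}"

definition D_tsu :: "nat \<Rightarrow> nat \<Rightarrow> nat \<Rightarrow> nat \<Rightarrow> (nat \<times> nat) set" where
  "D_tsu r t s u = {(1, u)} \<union> {(1, i) | i. s - t + 2 \<le> i \<and> i \<le> s}
     \<union> {(2, i) | i. 1 \<le> i \<and> i \<le> s} \<union> {(i, u) | i. 3 \<le> i \<and> i \<le> r}"

end

theory Submission
  imports Defs
begin

text \<open>
  Both parts are instances of one statement. Let the composition be \<open>(a, b, 1, \<dots>, 1)\<close> with
  \<open>m \<ge> 1\<close> parts 1 at the end, and for \<open>1 \<le> u \<le> b - a + 1\<close>, where \<open>b - a\<close> is 0 if \<open>a \<ge> b\<close>,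
  let \<open>D\<^sub>u\<close> be the diagram whose first row occupies column \<open>u\<close> and the columns \<open>b - a + i\<close> with
  \<open>2 \<le> i \<le> a\<close>, whose second row occupies the columns \<open>1, \<dots>, b\<close>, and whose remaining nodes lie in
  column \<open>u\<close> (\<open>hook_diagram\<close>). Then the minimal diagrams attached to the maximal elements of
  \<open>Z(a, b, 1, \<dots>, 1)\<close> are exactly the \<open>D\<^sub>u\<close>; for \<open>a \<ge> b\<close> only \<open>D\<^sub>1 = V(\<lambda>)\<close> is left, and for
  \<open>a \<le> b\<close> these are the diagrams \<open>D_tsu\<close>.

  Everything on the group side is expressed by inversion sets of positions: the length is their
  cardinality (\<open>cox_length_eq\<close>), the prefix order is their inclusion (\<open>cox_prefix_iff\<close>), \<open>X_J\<close>
  consists of the permutations increasing on blocks (\<open>X_J_eq\<close>), and \<open>w_J\<close> reverses each block.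

  Write \<open>\<alpha>\<^sub>1 < \<dots> < \<alpha>\<^sub>a\<close>, \<open>\<beta>\<^sub>1 < \<dots> < \<beta>\<^sub>b\<close> and \<open>\<gamma>\<^sub>1, \<dots>, \<gamma>\<^sub>m\<close> for the values of \<open>e\<close> on
  the blocks. The word of \<open>w_J e\<close> is \<open>\<alpha>\<^sub>a \<dots> \<alpha>\<^sub>1 \<beta>\<^sub>b \<dots> \<beta>\<^sub>1 \<gamma>\<^sub>1 \<dots> \<gamma>\<^sub>m\<close>, and its
  recording tableau is determined by the sequence of rows in which the insertions end. For
  \<open>w_J\<close> these rows (counted from 0) are \<open>0, \<dots>, a - 1\<close>, then \<open>0, \<dots>, b - 1\<close>, then \<open>0, \<dots>, 0\<close>.
  The first \<open>min a b\<close> of the letters \<open>\<beta>\<close> fill the second column in this way iff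
  \<open>\<alpha>\<^sub>i < \<beta>\<^bsub>b - min a b + i\<^esub>\<close> for all \<open>i \<le> min a b\<close>; the later ones then automatically open a
  new row each, because a letter of a decreasing run ends strictly below its predecessor.
  After both blocks the first row ends in the least \<open>\<beta>\<^sub>j\<close> above \<open>\<alpha>\<^sub>1\<close>, so the letters \<open>\<gamma>\<close> stay in the first
  row iff they increase and exceed some \<open>\<beta>\<^sub>j > \<alpha>\<^sub>1\<close>. This describes \<open>Z\<close> (\<open>Z_set_iff\<close>).

  If \<open>u\<close> is the least index with \<open>\<beta>\<^sub>u > \<alpha>\<^sub>1\<close>, these inequalities imply that every inversion
  of \<open>e\<close> is one of \<open>w_diag D\<^sub>u\<close>, since the inversions of \<open>w_diag D\<close> are the pairs of nodes
  whose order by rows is opposite to their order by columns (\<open>w_diag_coordinates\<close>). The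
  \<open>w_diag D\<^sub>u\<close> themselves lie in \<open>Z\<close> and are pairwise incomparable, so they form \<open>Y\<close>
  (\<open>Y_set_eq\<close>). Finally \<open>D\<^sub>u\<close> has \<open>max a b\<close> columns, which is forced by the two long rows; a diagram
  with the same permutation and as few columns has one full row, and the position of every other
  node relative to that row determines its column (\<open>hook_diagram_minimal\<close>).
\<close>

section \<open>Inversions, Coxeter length and the prefix order\<close>

text \<open>The inversions of a permutation, as pairs of positions.\<close>

definition Inv :: "(nat \<Rightarrow> nat) \<Rightarrow> (nat \<times> nat) set" where
  "Inv w = {(p, q). p < q \<and> w q < w p}"

lemma Inv_bounds:
  assumes "w permutes {1..n}" "(p, q) \<in> Inv w"
  shows "1 \<le> p" "p < q" "q \<le> n"
proof -
  have pq: "p < q" "w q < w p" using assms(2) by (auto simp: Inv_def)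
  show "p < q" by (fact pq)
  have out: "w i = i" if "i \<notin> {1..n}" for i
    using assms(1) that by (rule permutes_not_in)
  show "1 \<le> p"
    using pq out[of p] by (cases "p = 0") auto
  show "q \<le> n"
  proof (rule ccontr)
    assume "\<not> q \<le> n"
    then have q: "w q = q" using out by auto
    show False
    proof (cases "p \<in> {1..n}")
      case True
      then have "w p \<in> {1..n}" using permutes_in_image[OF assms(1)] by blast
      then show False using q pq \<open>\<not> q \<le> n\<close> by auto
    next
      case False
      then show False using out[of p] q pq by auto
    qed
  qed
qed

lemma finite_Inv:
  assumes "w permutes {1..n}"
  shows "finite (Inv w)"
proof (rule finite_subset)
  show "Inv w \<subseteq> {1..n} \<times> {1..n}"
    using Inv_bounds[OF assms] by fastforce
qed simp

lemma Inv_id [simp]: "Inv id = {}"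
  by (auto simp: Inv_def)

lemma cox_gen_permutes: "1 \<le> j \<Longrightarrow> j < n \<Longrightarrow> cox_gen j permutes {1..n}"
  unfolding cox_gen_def by (rule permutes_swap_id) auto

lemma cox_gen_less_iff:
  "cox_gen j x < cox_gen j y \<longleftrightarrow> (if {x, y} = {j, Suc j} then y < x else x < y)"
  by (auto simp: cox_gen_def transpose_def doubleton_eq_iff)

lemma inj_cox_gen: "cox_gen i = cox_gen j \<Longrightarrow> i = j"
proof -
  assume a: "cox_gen i = cox_gen j"
  show "i = j"
    using fun_cong[OF a, of i] fun_cong[OF a, of j]
    by (auto simp: cox_gen_def transpose_def split: if_splits)
qed

text \<open>
  Multiplying on the right by \<open>s\<^sub>j\<close> exchanges the values \<open>j\<close> and \<open>j + 1\<close>, so only the pair of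
  positions holding them changes its inversion status.
\<close>

lemma Inv_cox_gen_up:
  assumes "inj x" "x p = j" "x q = Suc j" "p < q"
  shows "Inv (cox_gen j \<circ> x) = insert (p, q) (Inv x)" "(p, q) \<notin> Inv x"
proof -
  have eq: "x i = j \<longleftrightarrow> i = p" "x i = Suc j \<longleftrightarrow> i = q" for i
    using assms(2,3) inj_eq[OF assms(1)] by metis+
  show "(p, q) \<notin> Inv x" using assms by (auto simp: Inv_def)
  have "(i, k) \<in> Inv (cox_gen j \<circ> x) \<longleftrightarrow> (i, k) = (p, q) \<or> (i, k) \<in> Inv x" for i k
    using assms(2-4) eq(1)[of i] eq(2)[of i] eq(1)[of k] eq(2)[of k]
    by (auto simp: Inv_def cox_gen_less_iff doubleton_eq_iff split: if_splits)
  then show "Inv (cox_gen j \<circ> x) = insert (p, q) (Inv x)" by auto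
qed

lemma Inv_cox_gen_right:
  assumes x: "x permutes {1..n}" and j: "1 \<le> j" "j < n"
  shows "card (Inv (cox_gen j \<circ> x)) \<le> Suc (card (Inv x))"
    and "card (Inv (cox_gen j \<circ> x)) = Suc (card (Inv x)) \<Longrightarrow> Inv x \<subseteq> Inv (cox_gen j \<circ> x)"
proof -
  define y where "y = cox_gen j \<circ> x"
  have y: "y permutes {1..n}"
    unfolding y_def using x cox_gen_permutes[OF j] by (rule permutes_compose)
  obtain p q where pq: "x p = j" "x q = Suc j"
    using permutes_surj[OF x] by (metis surjD)
  have "p \<noteq> q" using pq by auto
  have inj: "inj x" "inj y" using x y permutes_inj by auto
  have "(Inv y = insert (p, q) (Inv x) \<and> (p, q) \<notin> Inv x) \<or>
        (Inv x = insert (q, p) (Inv y) \<and> (q, p) \<notin> Inv y)"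
  proof (cases "p < q")
    case True
    then show ?thesis using Inv_cox_gen_up[OF inj(1) pq True] by (simp add: y_def)
  next
    case False
    then have "q < p" using \<open>p \<noteq> q\<close> by simp
    have "y q = j" "y p = Suc j"
      using pq by (auto simp: y_def cox_gen_def)
    moreover have "cox_gen j \<circ> y = x"
      by (auto simp: y_def cox_gen_def fun_eq_iff)
    ultimately show ?thesis
      using Inv_cox_gen_up[OF inj(2), of q j p] \<open>q < p\<close> by auto
  qed
  then show "card (Inv y) \<le> Suc (card (Inv x))"
    and "card (Inv y) = Suc (card (Inv x)) \<Longrightarrow> Inv x \<subseteq> Inv y"
    using finite_Inv[OF x] finite_Inv[OF y] by auto
qed

text \<open>The group product of a list of permutations, multiplied from left to right.\<close>

definition word_prod :: "(nat \<Rightarrow> nat) list \<Rightarrow> nat \<Rightarrow> nat" where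
  "word_prod ws = foldr (\<lambda>x y. y \<circ> x) ws id"

lemma word_prod_simps [simp]:
  "word_prod [] = id" "word_prod (x # xs) = word_prod xs \<circ> x"
  by (simp_all add: word_prod_def)

lemma word_prod_append: "word_prod (us @ vs) = word_prod vs \<circ> word_prod us"
  by (induction us) (auto simp: comp_assoc)

lemma expression_iff: "expression n ws w \<longleftrightarrow> set ws \<subseteq> cox_gens n \<and> word_prod ws = w"
  by (simp add: expression_def word_prod_def symg_def)

text \<open>
  Each factor adds at most one inversion; if all of them do, no inversion is lost on the way.
\<close>

lemma Inv_word_prod:
  assumes "x permutes {1..n}" "set vs \<subseteq> cox_gens n"
  shows "card (Inv (word_prod vs \<circ> x)) \<le> card (Inv x) + length vs \<and>
    (card (Inv (word_prod vs \<circ> x)) = card (Inv x) + length vs \<longrightarrow> Inv x \<subseteq> Inv (word_prod vs \<circ> x))"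
  using assms
proof (induction vs arbitrary: x)
  case Nil
  then show ?case by simp
next
  case (Cons g vs)
  then obtain j where j: "1 \<le> j" "j < n" "g = cox_gen j"
    by (auto simp: cox_gens_def)
  have gx: "g \<circ> x permutes {1..n}"
    unfolding j using Cons.prems(1) cox_gen_permutes[OF j(1,2)] by (rule permutes_compose)
  note IH = Cons.IH[OF gx]
  note st = Inv_cox_gen_right[OF Cons.prems(1) j(1,2), folded j(3)]
  have eq: "word_prod (g # vs) \<circ> x = word_prod vs \<circ> (g \<circ> x)" by auto
  show ?case
  proof (unfold eq, intro conjI impI)
    have sub: "set vs \<subseteq> cox_gens n" using Cons.prems(2) by simp
    show *: "card (Inv (word_prod vs \<circ> (g \<circ> x))) \<le> card (Inv x) + length (g # vs)"
      using IH[OF sub] st(1) unfolding list.size by linarith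
    assume "card (Inv (word_prod vs \<circ> (g \<circ> x))) = card (Inv x) + length (g # vs)"
    then have "card (Inv (g \<circ> x)) = Suc (card (Inv x))"
      "card (Inv (word_prod vs \<circ> (g \<circ> x))) = card (Inv (g \<circ> x)) + length vs"
      using IH[OF sub] st(1) unfolding list.size by linarith+
    then show "Inv x \<subseteq> Inv (word_prod vs \<circ> (g \<circ> x))"
      using IH[OF sub] st(2) by blast
  qed
qed

lemma increasing_permutation_id:
  assumes v: "v permutes {1..n}" and inc: "\<And>j. 1 \<le> j \<Longrightarrow> j < n \<Longrightarrow> v j < v (Suc j)"
  shows "v = id"
proof -
  have lt: "v i < v k" if "1 \<le> i" "i < k" "k \<le> n" for i k
    using that(2,3,1)
  proof (induction k)
    case 0
    then show ?case by simp
  next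
    case (Suc k)
    then show ?case using inc[of k] by (cases "i = k") force+
  qed
  have ge: "i \<le> v i" if "1 \<le> i" "i \<le> n" for i
    using that
  proof (induction i)
    case 0
    then show ?case by simp
  next
    case (Suc i)
    have "v (Suc i) \<in> {1..n}" using permutes_in_image[OF v] Suc.prems by simp
    then show ?case using Suc inc[of i] by (cases "i = 0") force+
  qed
  have le: "v i \<le> i" if "1 \<le> i" "i \<le> n" for i
  proof -
    have "v ` {i..n} \<subseteq> {v i..n}"
    proof
      fix z assume "z \<in> v ` {i..n}"
      then obtain k where k: "z = v k" "k \<in> {i..n}" by auto
      then have "z \<in> {1..n}" using permutes_in_image[OF v, of k] that by auto
      moreover have "v i \<le> v k" using lt[of i k] k(2) that by (cases "i = k") auto
      ultimately show "z \<in> {v i..n}" using k by auto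
    qed
    then have "card (v ` {i..n}) \<le> card {v i..n}" by (rule card_mono[rotated]) simp
    moreover have "card (v ` {i..n}) = card {i..n}"
      using permutes_inj_on[OF v] by (rule card_image)
    moreover have "v i \<le> n" using permutes_in_image[OF v, of i] that by auto
    ultimately show ?thesis using that by auto
  qed
  show ?thesis
    using ge le permutes_not_in[OF v] by (metis antisym atLeastAtMost_iff eq_id_iff)
qed

text \<open>
  If \<open>Inv x \<subset> Inv y\<close>, a step upwards from \<open>x\<close> that stays below \<open>y\<close> is found at a descent of
  \<open>x\<^sup>-\<^sup>1y\<close> (a right action product).
\<close>

lemma Inv_step_below:
  assumes x: "x permutes {1..n}" and y: "y permutes {1..n}"
    and sub: "Inv x \<subseteq> Inv y" and ne: "x \<noteq> y"
  obtains j p q where "1 \<le> j" "j < n" "x p = j" "x q = Suc j" "(p, q) \<in> Inv y"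
    "(p, q) \<notin> Inv x" "Inv (cox_gen j \<circ> x) = insert (p, q) (Inv x)"
proof -
  define v where "v = y \<circ> Hilbert_Choice.inv x"
  have v: "v permutes {1..n}"
    unfolding v_def using permutes_inv[OF x] y by (rule permutes_compose)
  have vx: "v (x i) = y i" for i
    using permutes_inverses[OF x] by (simp add: v_def)
  have "v \<noteq> id"
    using ne vx by (metis id_apply ext)
  then obtain j where j: "1 \<le> j" "j < n" "\<not> v j < v (Suc j)"
    using increasing_permutation_id[OF v] by blast
  obtain p q where pq: "x p = j" "x q = Suc j"
    using permutes_surj[OF x] by (metis surjD)
  have "p \<noteq> q" using pq by auto
  have "y p \<noteq> y q" using permutes_inj[OF y] \<open>p \<noteq> q\<close> by (auto dest: injD)
  then have gt: "y q < y p" using j(3) pq vx[of p] vx[of q] by simp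
  have "p < q"
  proof (rule ccontr)
    assume "\<not> p < q"
    then have "(q, p) \<in> Inv x" using pq \<open>p \<noteq> q\<close> by (auto simp: Inv_def)
    then show False using sub gt by (auto simp: Inv_def)
  qed
  then show ?thesis
    using that[OF j(1,2) pq] gt Inv_cox_gen_up[OF permutes_inj[OF x] pq] by (auto simp: Inv_def)
qed

lemma reduced_chain:
  assumes "x permutes {1..n}" and "y permutes {1..n}" and "Inv x \<subseteq> Inv y"
  shows "\<exists>vs. set vs \<subseteq> cox_gens n \<and> word_prod vs \<circ> x = y \<and>
           card (Inv y) = card (Inv x) + length vs"
  using assms
proof (induction "card (Inv y) - card (Inv x)" arbitrary: x rule: less_induct)
  case less
  show ?case
  proof (cases "x = y")
    case True
    then show ?thesis by (intro exI[of _ "[]"]) auto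
  next
    case False
    then obtain j p q where j: "1 \<le> j" "j < n" "(p, q) \<in> Inv y"
      "(p, q) \<notin> Inv x" "Inv (cox_gen j \<circ> x) = insert (p, q) (Inv x)"
      using Inv_step_below less.prems by metis
    let ?x = "cox_gen j \<circ> x"
    have fin: "finite (Inv x)" "finite (Inv y)" using less.prems finite_Inv by auto
    have px: "?x permutes {1..n}"
      using less.prems(1) cox_gen_permutes[OF j(1,2)] by (rule permutes_compose)
    have sub: "Inv ?x \<subseteq> Inv y" using j less.prems by auto
    have c: "card (Inv ?x) = Suc (card (Inv x))" using j fin by simp
    have "card (Inv ?x) \<le> card (Inv y)" using sub fin by (simp add: card_mono)
    then obtain vs where vs: "set vs \<subseteq> cox_gens n" "word_prod vs \<circ> ?x = y"
      "card (Inv y) = card (Inv ?x) + length vs"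
      using less.hyps[OF _ px less.prems(2) sub] c by (metis Suc_le_eq diff_less_mono2 lessI)
    show ?thesis
      using vs c j by (intro exI[of _ "cox_gen j # vs"]) (auto simp: cox_gens_def comp_assoc)
  qed
qed

lemma Inv_inject:
  assumes "x permutes {1..n}" "y permutes {1..n}" "Inv x = Inv y"
  shows "x = y"
  using reduced_chain[OF assms(1,2)] assms(3) by auto

lemma cox_length_eq:
  assumes "w permutes {1..n}"
  shows "cox_length n w = card (Inv w)"
  unfolding cox_length_def
proof (rule Least_equality)
  show "\<exists>ws. expression n ws w \<and> length ws = card (Inv w)"
    using reduced_chain[OF permutes_id assms] by (auto simp: expression_iff)
next
  fix k assume "\<exists>ws. expression n ws w \<and> length ws = k"
  then show "card (Inv w) \<le> k"
    using Inv_word_prod[OF permutes_id] by (fastforce simp: expression_iff)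
qed

lemma cox_prefix_iff:
  assumes x: "x permutes {1..n}" and y: "y permutes {1..n}"
  shows "cox_prefix n x y \<longleftrightarrow> Inv x \<subseteq> Inv y"
proof
  assume "cox_prefix n x y"
  then obtain us vs where h: "expression n us x" "length us = card (Inv x)"
    "expression n (us @ vs) y" "length (us @ vs) = card (Inv y)"
    by (auto simp: cox_prefix_def reduced_expression_def cox_length_eq[OF x] cox_length_eq[OF y])
  then show "Inv x \<subseteq> Inv y"
    using Inv_word_prod[OF x, of vs] by (auto simp: expression_iff word_prod_append)
next
  assume sub: "Inv x \<subseteq> Inv y"
  obtain us where us: "set us \<subseteq> cox_gens n" "word_prod us = x" "card (Inv x) = length us"
    using reduced_chain[OF permutes_id x] by auto
  obtain vs where vs: "set vs \<subseteq> cox_gens n" "word_prod vs \<circ> x = y"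
      "card (Inv y) = card (Inv x) + length vs"
    using reduced_chain[OF x y sub] by auto
  show "cox_prefix n x y"
    unfolding cox_prefix_def reduced_expression_def cox_length_eq[OF x] cox_length_eq[OF y]
    using us vs by (intro exI[of _ us] exI[of _ vs]) (auto simp: expression_iff word_prod_append)
qed

section \<open>Young subgroups and their coset representatives\<close>

text \<open>The positions after which a new part of the composition starts.\<close>

definition breaks :: "nat list \<Rightarrow> nat set" where
  "breaks lam = {sum_list (take k lam) | k. 1 \<le> k \<and> k < length lam}"

text \<open>The permutations of \<open>{1..n}\<close> preserving every initial segment \<open>{1..k}\<close> with \<open>k \<in> K\<close>.\<close>

definition young :: "nat \<Rightarrow> nat set \<Rightarrow> (nat \<Rightarrow> nat) set" where
  "young n K = {w. w permutes {1..n} \<and> (\<forall>k\<in>K. \<forall>p. w p \<le> k \<longleftrightarrow> p \<le> k)}"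

lemma cox_gen_le_iff: "k \<noteq> j \<Longrightarrow> cox_gen j p \<le> k \<longleftrightarrow> p \<le> k"
  by (auto simp: cox_gen_def transpose_def)

lemma J_gens_eq: "J_gens lam = cox_gen ` ({1..<sum_list lam} - breaks lam)"
proof -
  have "{cox_gen (sum_list (take k lam)) | k. 1 \<le> k \<and> k < length lam} = cox_gen ` breaks lam"
    by (auto simp: breaks_def)
  moreover have "inj cox_gen" by (rule injI) (rule inj_cox_gen)
  ultimately show ?thesis
    by (simp add: J_gens_def cox_gens_def image_set_diff)
qed

lemma id_young: "id \<in> young n K"
  unfolding young_def using permutes_id[of "{1..n}"] by (simp only: mem_Collect_eq id_apply) simp

lemma cox_gen_young:
  assumes "j \<in> {1..<n} - K"
  shows "cox_gen j \<in> young n K"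
proof -
  have "cox_gen j permutes {1..n}" using assms by (intro cox_gen_permutes) auto
  moreover have "cox_gen j p \<le> k \<longleftrightarrow> p \<le> k" if "k \<in> K" for k p
    using that assms by (intro cox_gen_le_iff) auto
  ultimately show ?thesis unfolding young_def by blast
qed

lemma young_comp: "x \<in> young n K \<Longrightarrow> y \<in> young n K \<Longrightarrow> y \<circ> x \<in> young n K"
  unfolding young_def using permutes_compose[of x "{1..n}" y] by simp

lemma young_inv:
  assumes "x \<in> young n K"
  shows "Hilbert_Choice.inv x \<in> young n K"
proof -
  have x: "x permutes {1..n}" using assms by (simp add: young_def)
  have "Hilbert_Choice.inv x p \<le> k \<longleftrightarrow> p \<le> k" if "k \<in> K" for k p
  proof -
    have "x (Hilbert_Choice.inv x p) \<le> k \<longleftrightarrow> Hilbert_Choice.inv x p \<le> k"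
      using assms that unfolding young_def by blast
    then show ?thesis by (simp add: permutes_inverses(1)[OF x])
  qed
  then show ?thesis using permutes_inv[OF x] unfolding young_def by blast
qed

lemma Inv_young:
  assumes "x \<in> young n K" "(p, q) \<in> Inv x" "k \<in> K"
  shows "\<not> (p \<le> k \<and> k < q)"
proof
  assume "p \<le> k \<and> k < q"
  then have "x p \<le> k" "\<not> x q \<le> k" using assms(1,3) unfolding young_def by (blast, force)
  then show False using assms(2) by (simp add: Inv_def)
qed

lemma symg_mult: "x \<otimes>\<^bsub>symg n\<^esub> y = y \<circ> x"
  by (simp add: symg_def)

lemma inv_cox_gen:
  assumes "1 \<le> j" "j < n"
  shows "inv\<^bsub>symg n\<^esub> (cox_gen j) = cox_gen j"
proof -
  have inv: "cox_gen j \<circ> cox_gen j = id" by (simp add: cox_gen_def)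
  show ?thesis
    unfolding m_inv_def
  proof (rule the_equality)
    show "cox_gen j \<in> carrier (symg n) \<and> cox_gen j \<otimes>\<^bsub>symg n\<^esub> cox_gen j = \<one>\<^bsub>symg n\<^esub> \<and>
        cox_gen j \<otimes>\<^bsub>symg n\<^esub> cox_gen j = \<one>\<^bsub>symg n\<^esub>"
      using cox_gen_permutes[OF assms] inv by (simp add: symg_def)
  next
    fix y assume "y \<in> carrier (symg n) \<and> cox_gen j \<otimes>\<^bsub>symg n\<^esub> y = \<one>\<^bsub>symg n\<^esub> \<and>
        y \<otimes>\<^bsub>symg n\<^esub> cox_gen j = \<one>\<^bsub>symg n\<^esub>"
    then have "y \<circ> cox_gen j = id" by (simp add: symg_def)
    then show "y = cox_gen j" using inv by (metis comp_assoc comp_id id_comp)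
  qed
qed

lemma W_J_eq: "W_J lam = young (sum_list lam) (breaks lam)"
proof
  let ?n = "sum_list lam" and ?K = "breaks lam"
  show "W_J lam \<subseteq> young ?n ?K"
  proof
    fix w assume "w \<in> W_J lam"
    then have "w \<in> generate (symg ?n) (J_gens lam)" by (simp add: W_J_def)
    then show "w \<in> young ?n ?K"
    proof (induction rule: generate.induct)
      case one
      have "\<one>\<^bsub>symg ?n\<^esub> = id" by (simp add: symg_def)
      then show ?case using id_young by metis
    next
      case (incl h)
      then show ?case using cox_gen_young by (auto simp: J_gens_eq)
    next
      case (inv h)
      then obtain j where "h = cox_gen j" "j \<in> {1..<?n} - ?K" by (auto simp: J_gens_eq)
      then show ?case using cox_gen_young[of j] inv_cox_gen[of j] by simp
    next
      case (eng h1 h2)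
      then show ?case using young_comp unfolding symg_mult by blast
    qed
  qed
  \<comment> \<open>A step below a block-preserving permutation only exchanges values within one block.\<close>
  have "\<exists>v \<in> W_J lam. v \<circ> x = y" if "x \<in> young ?n ?K" "y \<in> young ?n ?K" "Inv x \<subseteq> Inv y" for x y
    using that
  proof (induction "card (Inv y) - card (Inv x)" arbitrary: x rule: less_induct)
    case less
    have perm: "x permutes {1..?n}" "y permutes {1..?n}"
      using less.prems by (auto simp: young_def)
    have fin: "finite (Inv x)" "finite (Inv y)" using perm finite_Inv by auto
    show ?case
    proof (cases "x = y")
      case True
      have "id \<in> W_J lam" using generate.one[of "symg ?n"] by (simp add: W_J_def symg_def)
      then show ?thesis using True by (intro bexI[of _ id]) auto
    next
      case False
      then obtain j p q where j: "1 \<le> j" "j < ?n" "x p = j" "x q = Suc j" "(p, q) \<in> Inv y"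
        "(p, q) \<notin> Inv x" "Inv (cox_gen j \<circ> x) = insert (p, q) (Inv x)"
        using Inv_step_below[OF perm less.prems(3)] by metis
      have "p < q" using j(5) by (simp add: Inv_def)
      have "j \<notin> ?K"
      proof
        assume "j \<in> ?K"
        then have "p \<le> j" "\<not> q \<le> j" using less.prems(1) j(3,4) by (force simp: young_def)+
        then show False using Inv_young[OF less.prems(2) j(5) \<open>j \<in> ?K\<close>] by simp
      qed
      then have jJ: "j \<in> {1..<?n} - ?K" using j by simp
      let ?x = "cox_gen j \<circ> x"
      have sub: "Inv ?x \<subseteq> Inv y" using j(5,7) less.prems(3) by simp
      have "card (Inv ?x) = Suc (card (Inv x))" using j fin by simp
      moreover have "card (Inv ?x) \<le> card (Inv y)" using sub fin by (simp add: card_mono)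
      ultimately obtain v where v: "v \<in> W_J lam" "v \<circ> ?x = y"
        using less.hyps[OF _ young_comp[OF less.prems(1) cox_gen_young[OF jJ]] less.prems(2) sub]
        by (metis Suc_le_eq diff_less_mono2 lessI)
      have "cox_gen j \<in> W_J lam"
        unfolding W_J_def by (rule generate.incl) (use jJ in \<open>auto simp: J_gens_eq\<close>)
      then have "v \<circ> cox_gen j \<in> W_J lam"
        using v(1) generate.eng[of "cox_gen j" "symg ?n" "J_gens lam" v]
        unfolding W_J_def symg_mult by blast
      then show ?thesis using v(2) by (intro bexI[of _ "v \<circ> cox_gen j"]) (auto simp: comp_assoc)
    qed
  qed
  then show "young ?n ?K \<subseteq> W_J lam" using id_young by (metis Inv_id comp_id empty_subsetI subsetI)
qed

text \<open>
  An element of the Young subgroup in which every pair of positions within one block is inverted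
  is the longest one, because other pairs are never inverted.
\<close>

lemma w_J_eqI:
  assumes w: "w \<in> young (sum_list lam) (breaks lam)"
    and max: "\<And>p q. 1 \<le> p \<Longrightarrow> p < q \<Longrightarrow> q \<le> sum_list lam \<Longrightarrow>
      \<forall>k\<in>breaks lam. \<not> (p \<le> k \<and> k < q) \<Longrightarrow> w q < w p"
  shows "w_J lam = w"
proof -
  let ?n = "sum_list lam" and ?Y = "young (sum_list lam) (breaks lam)"
  have perm: "x permutes {1..?n}" if "x \<in> ?Y" for x using that by (simp add: young_def)
  have sub: "Inv x \<subseteq> Inv w" if "x \<in> ?Y" for x
  proof (rule subrelI)
    fix p q assume pq: "(p, q) \<in> Inv x"
    show "(p, q) \<in> Inv w"
      using Inv_bounds[OF perm[OF that] pq] Inv_young[OF that pq] max by (simp add: Inv_def)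
  qed
  have le: "cox_length ?n x \<le> cox_length ?n w" if "x \<in> ?Y" for x
    using sub[OF that] perm[OF that] perm[OF w] by (simp add: cox_length_eq card_mono finite_Inv)
  show ?thesis
    unfolding w_J_def W_J_eq
  proof (rule the_equality)
    show "is_arg_max (cox_length ?n) (\<lambda>w. w \<in> ?Y) w"
      using w le by (auto simp: is_arg_max_def not_less)
  next
    fix x assume "is_arg_max (cox_length ?n) (\<lambda>w. w \<in> ?Y) x"
    then have x: "x \<in> ?Y" "\<not> cox_length ?n x < cox_length ?n w"
      using w by (auto simp: is_arg_max_def)
    then have "card (Inv w) \<le> card (Inv x)"
      using perm[OF x(1)] perm[OF w] by (simp add: cox_length_eq)
    then have "Inv x = Inv w"
      using sub[OF x(1)] finite_Inv[OF perm[OF w]] by (simp add: card_seteq)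
    then show "x = w" using perm[OF x(1)] perm[OF w] by (rule Inv_inject[rotated 2])
  qed
qed

lemma X_J_eq:
  "X_J lam = {d. d permutes {1..sum_list lam} \<and>
     (\<forall>i. 1 \<le> i \<and> i < sum_list lam \<and> i \<notin> breaks lam \<longrightarrow> d i < d (Suc i))}"
proof -
  let ?n = "sum_list lam" and ?K = "breaks lam"
  have coset: "(W_J lam #>\<^bsub>symg ?n\<^esub> d) = (\<lambda>h. d \<circ> h) ` young ?n ?K" for d
    unfolding r_coset_def symg_mult W_J_eq by blast
  have "(\<forall>h \<in> young ?n ?K. card (Inv d) \<le> card (Inv (d \<circ> h))) \<longleftrightarrow>
     (\<forall>i. 1 \<le> i \<and> i < ?n \<and> i \<notin> ?K \<longrightarrow> d i < d (Suc i))" (is "?L \<longleftrightarrow> ?R")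
    if d: "d permutes {1..?n}" for d
  proof
    assume L: ?L
    show ?R
    proof (intro allI impI, rule ccontr)
      fix i assume i: "1 \<le> i \<and> i < ?n \<and> i \<notin> ?K" and "\<not> d i < d (Suc i)"
      let ?s = "cox_gen i"
      have "d i \<noteq> d (Suc i)" by (simp add: inj_eq[OF permutes_inj[OF d]])
      then have gt: "d (Suc i) < d i" using \<open>\<not> d i < d (Suc i)\<close> by simp
      have s: "?s \<in> young ?n ?K" using cox_gen_young i by simp
      have "inj ?s" using s permutes_inj by (auto simp: young_def)
      have ds: "d \<circ> ?s permutes {1..?n}"
        using s d permutes_compose[of ?s _ d] unfolding young_def by blast
      \<comment> \<open>Exchanging positions \<open>i\<close> and \<open>i + 1\<close> removes the inversion there and keeps all others.\<close>
      have "map_prod ?s ?s ` Inv (d \<circ> ?s) \<subseteq> Inv d - {(i, Suc i)}"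
      proof
        fix z assume "z \<in> map_prod ?s ?s ` Inv (d \<circ> ?s)"
        then obtain p q where z: "z = (?s p, ?s q)" and "(p, q) \<in> Inv (d \<circ> ?s)" by auto
        then have pq: "p < q" "d (?s q) < d (?s p)" by (auto simp: Inv_def)
        have "\<not> (p = i \<and> q = Suc i)" using pq gt by (auto simp: cox_gen_def)
        then have "?s p < ?s q" using pq(1) by (auto simp: cox_gen_less_iff doubleton_eq_iff)
        moreover have "(?s p, ?s q) \<noteq> (i, Suc i)"
          using pq(1) by (auto simp: cox_gen_def transpose_def split: if_splits)
        ultimately show "z \<in> Inv d - {(i, Suc i)}"
          using pq(2) z by (simp add: Inv_def)
      qed
      then have "card (map_prod ?s ?s ` Inv (d \<circ> ?s)) \<le> card (Inv d - {(i, Suc i)})"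
        using finite_Inv[OF d] by (simp add: card_mono)
      moreover have "card (map_prod ?s ?s ` Inv (d \<circ> ?s)) = card (Inv (d \<circ> ?s))"
        using \<open>inj ?s\<close> by (intro card_image inj_on_subset[OF map_prod_inj_on[of ?s UNIV ?s UNIV]]) simp_all
      moreover have "card (Inv d - {(i, Suc i)}) < card (Inv d)"
        using gt finite_Inv[OF d] by (intro card_Diff1_less) (simp_all add: Inv_def)
      ultimately have "card (Inv (d \<circ> ?s)) < card (Inv d)" by linarith
      then show False using bspec[OF L s] by linarith
    qed
  next
    assume R: ?R
    have sep: "\<exists>k\<in>?K. p \<le> k \<and> k < q" if pq: "(p, q) \<in> Inv d" for p q
    proof (rule ccontr)
      assume no: "\<not> (\<exists>k\<in>?K. p \<le> k \<and> k < q)"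
      have b: "1 \<le> p" "p < q" "q \<le> ?n" using Inv_bounds[OF d pq] .
      have "d p < d q'" if "p < q'" "q' \<le> q" for q'
        using that
      proof (induction q')
        case 0
        then show ?case by simp
      next
        case (Suc k)
        have "k \<notin> ?K" using no Suc.prems by auto
        then have "d k < d (Suc k)" using R Suc.prems b by auto
        then show ?case using Suc by (cases "p = k") auto
      qed
      then have "d p < d q" using b by simp
      then show False using pq by (simp add: Inv_def)
    qed
    show ?L
    proof
      fix h assume h: "h \<in> young ?n ?K"
      let ?g = "Hilbert_Choice.inv h"
      have hp: "h permutes {1..?n}" using h by (simp add: young_def)
      have g: "?g \<in> young ?n ?K" using h by (rule young_inv)
      have hg: "h (?g p) = p" for p using permutes_inverses[OF hp] by simp
      have "inj ?g" using permutes_inv[OF hp] by (rule permutes_inj)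
      have dh: "d \<circ> h permutes {1..?n}" using hp d by (rule permutes_compose)
      \<comment> \<open>Inversions of \<open>d\<close> join different blocks, so \<open>h\<^sup>-\<^sup>1\<close> keeps their order.\<close>
      have "map_prod ?g ?g ` Inv d \<subseteq> Inv (d \<circ> h)"
      proof
        fix z assume "z \<in> map_prod ?g ?g ` Inv d"
        then obtain p q where z: "z = (?g p, ?g q)" and pq: "(p, q) \<in> Inv d" by auto
        then obtain k where k: "k \<in> ?K" "p \<le> k" "k < q" using sep by blast
        then have "?g p \<le> k" "\<not> ?g q \<le> k" using g by (auto simp: young_def)
        then have "?g p < ?g q" by linarith
        moreover have "d q < d p" using pq by (simp add: Inv_def)
        ultimately show "z \<in> Inv (d \<circ> h)"
          by (simp add: Inv_def hg z)
      qed
      then have "card (map_prod ?g ?g ` Inv d) \<le> card (Inv (d \<circ> h))"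
        using finite_Inv[OF dh] by (simp add: card_mono)
      moreover have "card (map_prod ?g ?g ` Inv d) = card (Inv d)"
        using \<open>inj ?g\<close> by (intro card_image inj_on_subset[OF map_prod_inj_on[of ?g UNIV ?g UNIV]]) simp_all
      ultimately show "card (Inv d) \<le> card (Inv (d \<circ> h))" by simp
    qed
  qed
  moreover have "d \<circ> h permutes {1..?n}" if "d permutes {1..?n}" "h \<in> young ?n ?K" for d h
    using that permutes_compose[of h _ d] unfolding young_def by blast
  ultimately have "(\<forall>x \<in> W_J lam #>\<^bsub>symg ?n\<^esub> d. cox_length ?n d \<le> cox_length ?n x) \<longleftrightarrow>
     (\<forall>i. 1 \<le> i \<and> i < ?n \<and> i \<notin> ?K \<longrightarrow> d i < d (Suc i))" if "d permutes {1..?n}" for d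
    unfolding coset ball_simps using that by (simp add: cox_length_eq)
  then show ?thesis
    unfolding X_J_def by (auto simp: symg_def)
qed

section \<open>Row insertion\<close>

text \<open>The insertion tableau after inserting \<open>x\<close>, and the index (from 0) of the row that grows.\<close>

fun ins :: "nat \<Rightarrow> nat list list \<Rightarrow> nat list list" where
  "ins x [] = [[x]]"
| "ins x (p # P) = (case row_insert x p of (p', None) \<Rightarrow> p' # P | (p', Some y) \<Rightarrow> p' # ins y P)"

fun endrow :: "nat \<Rightarrow> nat list list \<Rightarrow> nat" where
  "endrow x [] = 0"
| "endrow x (p # P) = (case row_insert x p of (p', None) \<Rightarrow> 0 | (p', Some y) \<Rightarrow> Suc (endrow y P))"

text \<open>Appends the label \<open>k\<close> to row \<open>i\<close> of a recording tableau, or opens a new row for it.\<close>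

fun add_at :: "nat \<Rightarrow> nat \<Rightarrow> nat list list \<Rightarrow> nat list list" where
  "add_at i k [] = [[k]]"
| "add_at 0 k (q # Q) = (q @ [k]) # Q"
| "add_at (Suc i) k (q # Q) = q # add_at i k Q"

lemma rs_insert_eq:
  "length P = length Q \<Longrightarrow> rs_insert k x (P, Q) = (ins x P, add_at (endrow x P) k Q)"
proof (induction P arbitrary: x Q)
  case Nil
  then show ?case by simp
next
  case (Cons p P)
  then obtain q Q' where "Q = q # Q'" "length P = length Q'" by (cases Q) auto
  then show ?case using Cons.IH[of Q'] by (auto split: prod.split option.split)
qed

lemma endrow_le: "endrow x P \<le> length P"
  by (induction P arbitrary: x) (auto split: prod.split option.split)

lemma length_ins: "length (ins x P) = (if endrow x P = length P then Suc (length P) else length P)"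
  by (induction P arbitrary: x) (auto split: prod.split option.split)

lemma length_add_at: "i \<le> length Q \<Longrightarrow>
    length (add_at i k Q) = (if i = length Q then Suc (length Q) else length Q)"
  by (induction i k Q rule: add_at.induct) auto

text \<open>The insertion tableau of the first \<open>m\<close> letters of the row-form of \<open>w\<close>.\<close>

fun insertion_tableau :: "(nat \<Rightarrow> nat) \<Rightarrow> nat \<Rightarrow> nat list list" where
  "insertion_tableau w 0 = []"
| "insertion_tableau w (Suc m) = ins (w (Suc m)) (insertion_tableau w m)"

text \<open>The row, counted from 0, in which the \<open>k\<close>-th insertion ends.\<close>

definition new_row :: "(nat \<Rightarrow> nat) \<Rightarrow> nat \<Rightarrow> nat" where
  "new_row w k = endrow (w k) (insertion_tableau w (k - 1))"

lemma new_row_Suc: "new_row w (Suc m) = endrow (w (Suc m)) (insertion_tableau w m)"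
  by (simp add: new_row_def)

lemma rs_fold:
  "fold (\<lambda>k. rs_insert k (w k)) [1..<Suc m] ([], []) = (insertion_tableau w m, recording_tableau m w) \<and>
   length (insertion_tableau w m) = length (recording_tableau m w)"
proof (induction m)
  case 0
  then show ?case by (simp add: recording_tableau_def)
next
  case (Suc m)
  have "fold (\<lambda>k. rs_insert k (w k)) [1..<Suc (Suc m)] ([], [])
      = rs_insert (Suc m) (w (Suc m)) (insertion_tableau w m, recording_tableau m w)"
    using Suc by simp
  also have "\<dots> = (insertion_tableau w (Suc m), add_at (new_row w (Suc m)) (Suc m) (recording_tableau m w))"
    using Suc by (simp add: rs_insert_eq new_row_Suc)
  finally have *: "fold (\<lambda>k. rs_insert k (w k)) [1..<Suc (Suc m)] ([], []) = \<dots>" .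
  then have "recording_tableau (Suc m) w = add_at (new_row w (Suc m)) (Suc m) (recording_tableau m w)"
    unfolding recording_tableau_def by simp
  with * show ?case
    using Suc endrow_le[of "w (Suc m)" "insertion_tableau w m"]
    by (simp add: length_add_at length_ins new_row_Suc)
qed

lemma recording_tableau_Suc:
  "recording_tableau (Suc m) w = add_at (new_row w (Suc m)) (Suc m) (recording_tableau m w)"
proof -
  have "recording_tableau (Suc m) w
      = snd (rs_insert (Suc m) (w (Suc m)) (fold (\<lambda>k. rs_insert k (w k)) [1..<Suc m] ([], [])))"
    by (simp add: recording_tableau_def)
  then show ?thesis
    using rs_fold[of w m] by (simp add: rs_insert_eq new_row_Suc del: upt_Suc)
qed

lemma mem_add_at: "i \<le> length Q \<Longrightarrow>
   (j < length (add_at i k Q) \<and> k' \<in> set (add_at i k Q ! j)) \<longleftrightarrow>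
   (j < length Q \<and> k' \<in> set (Q ! j)) \<or> (k' = k \<and> j = i)"
proof (induction i k Q arbitrary: j rule: add_at.induct)
  case (1 i k)
  then show ?case by auto
next
  case (2 k q Q)
  then show ?case by (cases j) auto
next
  case (3 i k q Q)
  then show ?case by (cases j) auto
qed

lemma mem_recording_tableau:
  "(j < length (recording_tableau m w) \<and> k \<in> set (recording_tableau m w ! j)) \<longleftrightarrow>
   1 \<le> k \<and> k \<le> m \<and> new_row w k = j"
proof (induction m)
  case 0
  then show ?case by (simp add: recording_tableau_def)
next
  case (Suc m)
  have "new_row w (Suc m) \<le> length (recording_tableau m w)"
    using rs_fold[of w m] endrow_le by (metis new_row_Suc)
  then show ?case
    unfolding recording_tableau_Suc using Suc by (auto simp: mem_add_at le_Suc_eq)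
qed

text \<open>A recording tableau carries the same information as the sequence of rows.\<close>

lemma recording_tableau_eq_iff:
  "recording_tableau n w = recording_tableau n w' \<longleftrightarrow> (\<forall>k. 1 \<le> k \<and> k \<le> n \<longrightarrow> new_row w k = new_row w' k)"
proof
  assume "recording_tableau n w = recording_tableau n w'"
  then show "\<forall>k. 1 \<le> k \<and> k \<le> n \<longrightarrow> new_row w k = new_row w' k"
    by (metis mem_recording_tableau)
next
  assume "\<forall>k. 1 \<le> k \<and> k \<le> n \<longrightarrow> new_row w k = new_row w' k"
  then show "recording_tableau n w = recording_tableau n w'"
  proof (induction n)
    case 0
    then show ?case by (simp add: recording_tableau_def)
  next
    case (Suc n)
    then show ?case by (simp add: recording_tableau_Suc)
  qed
qed

lemma row_insert_None_iff: "snd (row_insert x p) = None \<longleftrightarrow> (\<forall>y\<in>set p. y \<le> x)"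
  by (induction p) (auto split: prod.split)

lemma row_insert_None: "\<forall>y\<in>set p. y \<le> x \<Longrightarrow> row_insert x p = (p @ [x], None)"
  by (induction p) auto

text \<open>
  Inserting a smaller letter next bumps something, and what it bumps is smaller than what was
  bumped before. The row need not be sorted.
\<close>

lemma row_insert_twice:
  assumes "y < x" "row_insert x p = (p', b)"
  obtains p'' z where "row_insert y p' = (p'', Some z)" "\<And>c. b = Some c \<Longrightarrow> z < c"
proof -
  have "\<exists>p'' z. row_insert y p' = (p'', Some z) \<and> z \<le> x \<and> (\<forall>c. b = Some c \<longrightarrow> x < c)"
    using assms
  proof (induction p arbitrary: p' b)
    case Nil
    then show ?case by auto
  next
    case (Cons v p)
    show ?case
    proof (cases "x < v")
      case True
      then show ?thesis using Cons.prems by auto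
    next
      case False
      obtain p1 where p1: "row_insert x p = (p1, b)" "p' = v # p1"
        using Cons.prems False by (auto split: prod.splits)
      obtain p'' z where "row_insert y p1 = (p'', Some z)" "z \<le> x" "\<forall>c. b = Some c \<longrightarrow> x < c"
        using Cons.IH[OF Cons.prems(1) p1(1)] by blast
      then show ?thesis using False p1(2) by auto
    qed
  qed
  then show ?thesis using that by (meson le_less_trans)
qed

text \<open>
  The row bumping lemma: a smaller letter inserted next ends strictly below. In particular the
  \<open>i\<close>-th letter of a decreasing run ends in row \<open>i\<close> or below.
\<close>

lemma endrow_decreasing: "y < x \<Longrightarrow> endrow x P < endrow y (ins x P)"
proof (induction P arbitrary: x y)
  case Nil
  then show ?case by simp
next
  case (Cons p P)
  obtain p' b where r: "row_insert x p = (p', b)" by fastforce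
  obtain p'' z where z: "row_insert y p' = (p'', Some z)" "\<And>c. b = Some c \<Longrightarrow> z < c"
    using row_insert_twice[OF Cons.prems r] by blast
  show ?case
    using r z Cons.IH by (cases b) auto
qed

lemma new_row_decreasing_run:
  assumes "\<And>i. i < l \<Longrightarrow> 1 \<le> i \<Longrightarrow> w (N + Suc i) < w (N + i)" "i < l"
  shows "i \<le> new_row w (N + Suc i)"
  using assms(2)
proof (induction i)
  case 0
  then show ?case by simp
next
  case (Suc i)
  have "w (N + Suc (Suc i)) < w (N + Suc i)" using assms(1)[of "Suc i"] Suc.prems by simp
  then have "new_row w (N + Suc i) < new_row w (N + Suc (Suc i))"
    using endrow_decreasing by (simp add: new_row_Suc)
  then show ?case using Suc by simp
qed

text \<open>The tableau with columns \<open>xs\<close> and \<open>ys\<close>, where \<open>ys\<close> is not longer than \<open>xs\<close>.\<close>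

fun two_cols :: "nat list \<Rightarrow> nat list \<Rightarrow> nat list list" where
  "two_cols [] ys = []"
| "two_cols (x # xs) [] = [x] # two_cols xs []"
| "two_cols (x # xs) (y # ys) = [x, y] # two_cols xs ys"

lemma length_two_cols [simp]: "length (two_cols xs ys) = length xs"
  by (induction xs ys rule: two_cols.induct) auto

text \<open>
  A letter below the whole first column pushes that column down; the second column stays in place
  because bumping happens at the left end of each row.
\<close>

lemma insert_first_column:
  assumes "sorted_wrt (<) (z # xs)" "length ys \<le> length xs" "list_all2 (\<le>) (take (length ys) xs) ys"
  shows "endrow z (two_cols xs ys) = length xs \<and> (ys = [] \<longrightarrow> ins z (two_cols xs ys) = two_cols (z # xs) [])"
  using assms
  by (induction xs ys arbitrary: z rule: two_cols.induct) auto

text \<open>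
  A letter below the whole second column pushes that column down if the extended columns still
  form a tableau. Otherwise the bumping crosses over to the first column and runs to its lower end.
\<close>

lemma insert_second_column:
  assumes "sorted_wrt (<) xs" "sorted_wrt (<) (z # ys)" "length ys < length xs"
    "list_all2 (\<le>) (take (length ys) xs) ys"
  shows "if list_all2 (\<le>) (take (Suc (length ys)) xs) (z # ys)
    then endrow z (two_cols xs ys) = length ys \<and> ins z (two_cols xs ys) = two_cols xs (z # ys)
    else endrow z (two_cols xs ys) = length xs"
  using assms
proof (induction xs ys arbitrary: z rule: two_cols.induct)
  case (1 ys)
  then show ?case by simp
next
  case (2 x xs)
  then show ?case using insert_first_column[of x xs "[]"] by auto
next
  case (3 x xs y ys)
  have low: "endrow x (two_cols xs ys) = length xs"
    using 3 by (intro insert_first_column[THEN conjunct1]) auto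
  show ?case
  proof (cases "z < x")
    case True
    then show ?thesis using low by simp
  next
    case False
    have "z < y" using 3 by simp
    have IH: "if list_all2 (\<le>) (take (Suc (length ys)) xs) (y # ys)
      then endrow y (two_cols xs ys) = length ys \<and> ins y (two_cols xs ys) = two_cols xs (y # ys)
      else endrow y (two_cols xs ys) = length xs"
      using 3 by (intro "3.IH") auto
    show ?thesis
      using IH False \<open>z < y\<close> by (cases "list_all2 (\<le>) (take (Suc (length ys)) xs) (y # ys)") auto
  qed
qed

section \<open>Words that are decreasing on two blocks\<close>

lemma hd_ins: "P \<noteq> [] \<Longrightarrow> hd (ins x P) = fst (row_insert x (hd P))"
  by (cases P) (auto split: prod.split option.split)

lemma ins_neq_Nil [simp]: "ins x P \<noteq> []"
  by (cases P) (auto split: prod.split option.split)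

lemma insertion_tableau_neq_Nil: "0 < k \<Longrightarrow> insertion_tableau w k \<noteq> []"
  by (cases k) auto

lemma endrow_eq_0_iff: "P \<noteq> [] \<Longrightarrow> endrow x P = 0 \<longleftrightarrow> (\<forall>y\<in>set (hd P). y \<le> x)"
  using row_insert_None_iff[of x "hd P"] by (cases P) (auto split: prod.splits option.splits)

text \<open>
  From step \<open>N\<close> on all insertions stay in the first row iff the letters increase weakly, starting
  from the maximum of the first row at that time.
\<close>

lemma new_row_zero_run:
  assumes "0 < N"
  shows "(\<forall>k. N < k \<and> k \<le> l \<longrightarrow> new_row w k = 0) \<longleftrightarrow>
    (\<forall>k. N < k \<and> k \<le> l \<longrightarrow> (\<forall>v \<in> set (hd (insertion_tableau w N)). v \<le> w k) \<and>
       (\<forall>k'. N < k' \<and> k' < k \<longrightarrow> w k' \<le> w k))"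
proof -
  let ?T = "insertion_tableau w"
  define L where "L l \<longleftrightarrow> (\<forall>k. N < k \<and> k \<le> l \<longrightarrow> new_row w k = 0)" for l
  define Q where "Q k \<longleftrightarrow> (\<forall>v \<in> set (hd (?T N)). v \<le> w k) \<and> (\<forall>k'. N < k' \<and> k' < k \<longrightarrow> w k' \<le> w k)" for k
  define R where "R l \<longleftrightarrow> (\<forall>k. N < k \<and> k \<le> l \<longrightarrow> Q k)" for l
  have low: "L l \<longleftrightarrow> R l" if "l \<le> N" for l
  proof -
    have no: "\<not> (N < k \<and> k \<le> l)" for k using that by linarith
    show ?thesis unfolding L_def R_def using no by blast
  qed
  have "(L l \<longleftrightarrow> R l) \<and> (L l \<longrightarrow> set (hd (?T l)) = set (hd (?T N)) \<union> w ` {N<..l})"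
    if "N \<le> l" for l
    using that
  proof (induction l rule: nat_induct_at_least)
    case base
    show ?case using low[of N] by simp
  next
    case (Suc l)
    have ne: "?T l \<noteq> []" using Suc.hyps assms insertion_tableau_neq_Nil by simp
    have zero: "new_row w (Suc l) = 0 \<longleftrightarrow> (\<forall>y\<in>set (hd (?T l)). y \<le> w (Suc l))"
      by (simp add: new_row_Suc endrow_eq_0_iff[OF ne])
    have split: "(\<forall>k. N < k \<and> k \<le> Suc l \<longrightarrow> P k) \<longleftrightarrow>
        (\<forall>k. N < k \<and> k \<le> l \<longrightarrow> P k) \<and> P (Suc l)" for P
      unfolding le_Suc_eq using le_imp_less_Suc[OF Suc.hyps] by blast
    have L: "L (Suc l) \<longleftrightarrow> L l \<and> new_row w (Suc l) = 0"
      unfolding L_def by (rule split)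
    have R: "R (Suc l) \<longleftrightarrow> R l \<and> Q (Suc l)"
      unfolding R_def by (rule split)
    show ?case
    proof (cases "L l")
      case False
      then show ?thesis using Suc.IH L R by simp
    next
      case True
      then have S: "set (hd (?T l)) = set (hd (?T N)) \<union> w ` {N<..l}" and "R l"
        using Suc.IH by simp_all
      have "(\<forall>y\<in>set (hd (?T l)). y \<le> w (Suc l)) \<longleftrightarrow> Q (Suc l)"
        unfolding S Q_def less_Suc_eq_le by auto
      then have eq: "L (Suc l) \<longleftrightarrow> R (Suc l)"
        using L R zero True \<open>R l\<close> by simp
      have "set (hd (?T (Suc l))) = set (hd (?T N)) \<union> w ` {N<..Suc l}" if "L (Suc l)"
      proof -
        have "\<forall>y\<in>set (hd (?T l)). y \<le> w (Suc l)" using that L zero by simp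
        then have "hd (?T (Suc l)) = hd (?T l) @ [w (Suc l)]"
          by (simp add: hd_ins[OF ne] row_insert_None)
        moreover have "{N<..Suc l} = insert (Suc l) {N<..l}" using Suc.hyps by auto
        ultimately show ?thesis using S by simp
      qed
      then show ?thesis using eq by simp
    qed
  qed
  then have "L l \<longleftrightarrow> R l" using low[of l] nat_le_linear[of l N] by blast
  then show ?thesis unfolding L_def R_def Q_def .
qed

text \<open>The longest element of the Young subgroup of \<open>(a, b, 1, \<dots>, 1)\<close>.\<close>

definition block_rev :: "nat \<Rightarrow> nat \<Rightarrow> nat \<Rightarrow> nat" where
  "block_rev a b k = (if 1 \<le> k \<and> k \<le> a then a + 1 - k
     else if a < k \<and> k \<le> a + b then 2 * a + b + 1 - k else k)"

text \<open>
  The permutation \<open>e\<close> is increasing on the first two blocks of positions, so the word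
  \<open>w = e \<circ> block_rev a b\<close>, which is \<open>w_J e\<close> in right action notation, is decreasing on them.
  The list \<open>col1 k\<close> consists of the last \<open>k\<close> values of \<open>e\<close> on the first block and \<open>col2 j\<close> of the
  last \<open>j\<close> values on the second one. Injectivity of \<open>e\<close> is not needed, which is why the
  inequalities between different blocks are weak.
\<close>

locale two_blocks =
  fixes a b m :: nat and e :: "nat \<Rightarrow> nat"
  assumes a: "1 \<le> a" and b: "1 \<le> b"
    and inc1: "\<And>i j. 1 \<le> i \<Longrightarrow> i < j \<Longrightarrow> j \<le> a \<Longrightarrow> e i < e j"
    and inc2: "\<And>i j. 1 \<le> i \<Longrightarrow> i < j \<Longrightarrow> j \<le> b \<Longrightarrow> e (a + i) < e (a + j)"
begin

\<comment> \<open>The two columns grow at their left end.\<close>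
declare upt_Suc [simp del]

definition w :: "nat \<Rightarrow> nat" where "w = e \<circ> block_rev a b"

abbreviation T :: "nat \<Rightarrow> nat list list" where "T \<equiv> insertion_tableau w"

abbreviation col1 :: "nat \<Rightarrow> nat list" where "col1 k \<equiv> map e [Suc a - k..<Suc a]"

abbreviation col2 :: "nat \<Rightarrow> nat list" where "col2 j \<equiv> map e [Suc (a + b) - j..<Suc (a + b)]"

lemma w1: "k < a \<Longrightarrow> w (Suc k) = e (a - k)"
  by (simp add: w_def block_rev_def)

lemma w2: "j < b \<Longrightarrow> w (Suc (a + j)) = e (a + b - j)"
  by (simp add: w_def block_rev_def)

lemma w3: "a + b < k \<Longrightarrow> w k = e k"
  by (simp add: w_def block_rev_def)

lemma col1_Suc: "k < a \<Longrightarrow> col1 (Suc k) = e (a - k) # col1 k"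
  by (simp add: upt_conv_Cons Suc_diff_le)

lemma col2_Suc: "j < b \<Longrightarrow> col2 (Suc j) = e (a + b - j) # col2 j"
  by (simp add: upt_conv_Cons Suc_diff_le)

lemma sorted_col1: "sorted_wrt (<) (col1 k)" if "k \<le> a"
  unfolding sorted_wrt_map
  by (rule sorted_wrt_mono_rel[OF _ sorted_wrt_upt]) (use that inc1 in auto)

lemma sorted_col2: "sorted_wrt (<) (col2 j)" if "j \<le> b"
proof -
  have "e x < e y" if "Suc (a + b) - j \<le> x" "x < y" "y \<le> a + b" for x y
    using inc2[of "x - a" "y - a"] that \<open>j \<le> b\<close> by simp
  then show ?thesis
    unfolding sorted_wrt_map by (intro sorted_wrt_mono_rel[OF _ sorted_wrt_upt]) auto
qed

lemma block1_rows:
  assumes "k \<le> a"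
  shows "T k = two_cols (col1 k) [] \<and> (1 \<le> k \<longrightarrow> new_row w k = k - 1)"
  using assms
proof (induction k)
  case 0
  then show ?case by simp
next
  case (Suc k)
  have "sorted_wrt (<) (e (a - k) # col1 k)"
    using sorted_col1[of "Suc k"] col1_Suc[of k] Suc.prems by simp
  from insert_first_column[OF this, of "[]"] show ?case
    using Suc w1[of k] col1_Suc[of k] by (simp add: new_row_Suc)
qed

text \<open>The last \<open>j\<close> values on the second block can stand as second column next to the first block.\<close>

definition fits :: "nat \<Rightarrow> bool" where
  "fits j \<longleftrightarrow> list_all2 (\<le>) (take j (col1 a)) (col2 j)"

lemma fits_iff:
  assumes "j \<le> a" "j \<le> b"
  shows "fits j \<longleftrightarrow> (\<forall>i<j. e (Suc i) \<le> e (Suc (a + b) - j + i))"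
  using assms by (auto simp: fits_def list_all2_conv_all_nth)

text \<open>
  The first \<open>min a b\<close> letters of the second block go to the rows \<open>0, 1, \<dots>\<close> iff each of them
  pushes the second column down by one row.
\<close>

lemma block2_rows_upper:
  assumes "j \<le> min a b"
  shows "((\<forall>j'. 1 \<le> j' \<and> j' \<le> j \<longrightarrow> new_row w (a + j') = j' - 1) \<longleftrightarrow>
      (\<forall>j'. 1 \<le> j' \<and> j' \<le> j \<longrightarrow> fits j')) \<and>
    ((\<forall>j'. 1 \<le> j' \<and> j' \<le> j \<longrightarrow> fits j') \<longrightarrow>
      T (a + j) = two_cols (col1 a) (col2 j))"
  using assms
proof (induction j)
  case 0
  then show ?case using block1_rows[of a] by simp
next
  case (Suc j)
  let ?L = "\<lambda>j. \<forall>j'. 1 \<le> j' \<and> j' \<le> j \<longrightarrow> new_row w (a + j') = j' - 1"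
  let ?R = "\<lambda>j. \<forall>j'. 1 \<le> j' \<and> j' \<le> j \<longrightarrow> fits j'"
  have j: "j < a" "j < b" using Suc.prems by auto
  have IH: "?L j \<longleftrightarrow> ?R j" "?R j \<longrightarrow> T (a + j) = two_cols (col1 a) (col2 j)"
    using Suc by auto
  have L: "?L (Suc j) \<longleftrightarrow> ?L j \<and> new_row w (a + Suc j) = j" by (auto simp: le_Suc_eq)
  have R: "?R (Suc j) \<longleftrightarrow> ?R j \<and> fits (Suc j)" by (auto simp: le_Suc_eq)
  show ?case
  proof (cases "?R j")
    case False
    then show ?thesis using IH L R by blast
  next
    case True
    then have T: "T (a + j) = two_cols (col1 a) (col2 j)" using IH by blast
    have "fits j" using True by (cases "j = 0") (auto simp: fits_def)
    have len: "length (col2 j) = j" "length (col1 a) = a" using j by simp_all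
    have "if fits (Suc j)
      then endrow (e (a + b - j)) (T (a + j)) = j \<and> ins (e (a + b - j)) (T (a + j)) = two_cols (col1 a) (col2 (Suc j))
      else endrow (e (a + b - j)) (T (a + j)) = a"
      using insert_second_column[of "col1 a" "e (a + b - j)" "col2 j"] sorted_col1[of a]
        sorted_col2[of "Suc j"] j \<open>fits j\<close> unfolding T fits_def col2_Suc[OF j(2)] len by simp
    moreover have "new_row w (a + Suc j) = endrow (e (a + b - j)) (T (a + j))"
      "T (a + Suc j) = ins (e (a + b - j)) (T (a + j))"
      using w2[OF j(2)] by (simp_all add: new_row_Suc)
    ultimately show ?thesis
      using IH L R True j by (cases "fits (Suc j)") auto
  qed
qed

text \<open>
  The remaining letters of the second block need no condition: the \<open>j\<close>-th one ends in row \<open>j - 1\<close> or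
  below, and there are only \<open>j - 1\<close> rows once \<open>j > a\<close>.
\<close>

lemma block2_rows_lower:
  assumes "\<And>j. 1 \<le> j \<Longrightarrow> j \<le> min a b \<Longrightarrow> new_row w (a + j) = j - 1" "j \<le> b"
  shows "length (T (a + j)) = max a j \<and> (1 \<le> j \<longrightarrow> new_row w (a + j) = j - 1)"
  using assms(2)
proof (induction j)
  case 0
  then show ?case using block1_rows[of a] by simp
next
  case (Suc j)
  have len: "length (T (a + j)) = max a j" using Suc by simp
  have "new_row w (a + Suc j) = j"
  proof (cases "Suc j \<le> a")
    case True
    then show ?thesis using assms(1)[of "Suc j"] Suc.prems by simp
  next
    case False
    have "w (a + Suc i) < w (a + i)" if "i < b" "1 \<le> i" for i
      using that inc2[of "b - i" "b - i + 1"] w2[of i] w2[of "i - 1"] by (simp add: Suc_diff_le)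
    then have "j \<le> new_row w (a + Suc j)"
      using Suc.prems by (intro new_row_decreasing_run[of b]) auto
    moreover have "new_row w (a + Suc j) \<le> j"
      using endrow_le[of "w (Suc (a + j))" "T (a + j)"] len False by (simp add: new_row_Suc)
    ultimately show ?thesis by simp
  qed
  then show ?case
    using len by (auto simp: length_ins new_row_Suc)
qed

text \<open>
  While the second block is inserted, the first row has two entries. Its right entry is the least
  value of the second block so far that is not below \<open>e 1\<close>. Its left entry is \<open>e 1\<close> until a smaller
  letter arrives; all later letters are then smaller still and replace each other there.
\<close>

lemma first_row_block2:
  assumes "e 1 \<le> e (a + b)" "1 \<le> j" "j \<le> b"
  shows "\<exists>x y. hd (T (a + j)) = [x, y] \<and> x \<le> e 1 \<and> e 1 \<le> y \<and>
    (x = e 1 \<or> x = e (Suc (a + b) - j)) \<and>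
    (\<exists>i. Suc (a + b) - j \<le> i \<and> i \<le> a + b \<and> y = e i) \<and>
    (\<forall>i. Suc (a + b) - j \<le> i \<and> i \<le> a + b \<and> e 1 \<le> e i \<longrightarrow> y \<le> e i)"
  using assms(2,3)
proof (induction j rule: nat_induct_at_least)
  case base
  have "T a = two_cols (col1 a) []" using block1_rows[of a] by simp
  moreover have "col1 a = e 1 # map e [2..<Suc a]"
    using a by (simp add: upt_conv_Cons numeral_2_eq_2)
  ultimately have "hd (T a) = [e 1]" by simp
  moreover have "T a \<noteq> []" using a insertion_tableau_neq_Nil by simp
  ultimately have "hd (T (a + 1)) = [e 1, e (a + b)]"
    using w2[of 0] b assms(1) hd_ins[of "T a"] by simp
  then show ?case using assms(1)
    by (intro exI[of _ "e 1"] exI[of _ "e (a + b)"]) (auto simp del: insertion_tableau.simps)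
next
  case (Suc j)
  then obtain x y i where IH: "hd (T (a + j)) = [x, y]" "x \<le> e 1" "e 1 \<le> y"
    "x = e 1 \<or> x = e (Suc (a + b) - j)" "Suc (a + b) - j \<le> i" "i \<le> a + b" "y = e i"
    "\<forall>i. Suc (a + b) - j \<le> i \<and> i \<le> a + b \<and> e 1 \<le> e i \<longrightarrow> y \<le> e i"
    by auto
  define z where "z = e (a + b - j)"
  have j: "j < b" "1 \<le> j" using Suc by auto
  have less: "z < e i" if "Suc (a + b) - j \<le> i" "i \<le> a + b" for i
    using inc2[of "b - j" "i - a"] that j by (simp add: z_def)
  have zy: "z < y" using less IH by blast
  have zx: "z < x \<longleftrightarrow> z < e 1"
    using IH(2,4) less[of "Suc (a + b) - j"] j by auto
  have "hd (T (a + Suc j)) = fst (row_insert z [x, y])"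
    using w2[OF j(1)] hd_ins[of "T (a + j)"] a insertion_tableau_neq_Nil[of "a + j"] IH(1)
    by (simp add: z_def)
  then have hd: "hd (T (a + Suc j)) = (if z < x then [z, y] else [x, z])" using zy by simp
  have range: "(Suc (a + b) - Suc j \<le> k \<and> k \<le> a + b) \<longleftrightarrow> k = a + b - j \<or> (Suc (a + b) - j \<le> k \<and> k \<le> a + b)" for k
    using j by auto
  show ?case
  proof (cases "z < e 1")
    case True
    then have "hd (T (a + Suc j)) = [z, y]" using hd zx by simp
    moreover have "\<forall>k. Suc (a + b) - Suc j \<le> k \<and> k \<le> a + b \<and> e 1 \<le> e k \<longrightarrow> y \<le> e k"
      using range IH(8) True z_def by (metis not_le)
    moreover have "z = e (Suc (a + b) - Suc j)" by (simp add: z_def)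
    moreover have "\<exists>i. Suc (a + b) - Suc j \<le> i \<and> i \<le> a + b \<and> y = e i"
      using IH(5-7) range by blast
    ultimately show ?thesis using True IH(3) by (intro exI[of _ z] exI[of _ y]) simp
  next
    case False
    then have "hd (T (a + Suc j)) = [x, z]" using hd zx by simp
    moreover have "x = e 1" using IH(2,4) False less[of "Suc (a + b) - j"] j by force
    moreover have "\<forall>k. Suc (a + b) - Suc j \<le> k \<and> k \<le> a + b \<and> e 1 \<le> e k \<longrightarrow> z \<le> e k"
      using range less z_def by (metis order.refl less_imp_le)
    moreover have "\<exists>i. Suc (a + b) - Suc j \<le> i \<and> i \<le> a + b \<and> z = e i"
      using range z_def by blast
    ultimately show ?thesis using False by (intro exI[of _ x] exI[of _ z]) simp
  qed
qed

text \<open>The rows of the insertions are those obtained for \<open>e = id\<close>, that is, for the word of \<open>w_J\<close>.\<close>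

definition standard_rows :: bool where
  "standard_rows \<longleftrightarrow> (\<forall>k. 1 \<le> k \<and> k \<le> a + b + m \<longrightarrow>
     new_row w k = (if k \<le> a then k - 1 else if k \<le> a + b then k - a - 1 else 0))"

text \<open>
  The difference \<open>b - a\<close> is truncated, so that it equals \<open>b - min a b\<close>.
\<close>

lemma standard_rows_iff:
  "standard_rows \<longleftrightarrow>
     (\<forall>i. 1 \<le> i \<and> i \<le> a \<and> i \<le> b \<longrightarrow> e i \<le> e (a + (b - a) + i)) \<and>
     (\<forall>k. a + b < k \<and> k \<le> a + b + m \<longrightarrow> (\<exists>j. 1 \<le> j \<and> j \<le> b \<and> e 1 \<le> e (a + j) \<and> e (a + j) \<le> e k)) \<and>
     (\<forall>k k'. a + b < k' \<and> k' < k \<and> k \<le> a + b + m \<longrightarrow> e k' \<le> e k)"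
    (is "_ \<longleftrightarrow> ?C1 \<and> ?C2 \<and> ?C3")
proof -
  let ?t = "min a b"
  have split: "standard_rows \<longleftrightarrow> (\<forall>j. 1 \<le> j \<and> j \<le> b \<longrightarrow> new_row w (a + j) = j - 1) \<and>
      (\<forall>k. a + b < k \<and> k \<le> a + b + m \<longrightarrow> new_row w k = 0)" (is "_ \<longleftrightarrow> ?B \<and> ?S")
  proof
    assume s: standard_rows
    have ?B
    proof (intro allI impI)
      fix j assume "1 \<le> j \<and> j \<le> b"
      then show "new_row w (a + j) = j - 1"
        using s[unfolded standard_rows_def, rule_format, of "a + j"] by simp
    qed
    moreover have ?S using s unfolding standard_rows_def by simp
    ultimately show "?B \<and> ?S" by blast
  next
    assume BS: "?B \<and> ?S"
    show standard_rows
      unfolding standard_rows_def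
    proof (intro allI impI)
      fix k assume k: "1 \<le> k \<and> k \<le> a + b + m"
      consider "k \<le> a" | "a < k" "k \<le> a + b" | "a + b < k" by linarith
      then show "new_row w k = (if k \<le> a then k - 1 else if k \<le> a + b then k - a - 1 else 0)"
      proof cases
        case 1
        then show ?thesis using block1_rows[of k] k by simp
      next
        case 2
        moreover from this have "1 \<le> k - a \<and> k - a \<le> b" by linarith
        ultimately show ?thesis using BS[THEN conjunct1, rule_format, of "k - a"] by simp
      next
        case 3
        then show ?thesis using BS k by simp
      qed
    qed
  qed
  have "?B \<longleftrightarrow> (\<forall>j. 1 \<le> j \<and> j \<le> ?t \<longrightarrow> new_row w (a + j) = j - 1)"
    using block2_rows_lower by auto
  also have "\<dots> \<longleftrightarrow> (\<forall>j. 1 \<le> j \<and> j \<le> ?t \<longrightarrow> fits j)"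
    using block2_rows_upper[of ?t] by blast
  also have "\<dots> \<longleftrightarrow> ?C1"
  proof
    assume "\<forall>j. 1 \<le> j \<and> j \<le> ?t \<longrightarrow> fits j"
    then have "fits ?t" using a b by simp
    then have *: "e (Suc i) \<le> e (Suc (a + b) - ?t + i)" if "i < ?t" for i
      using fits_iff[of ?t] that by simp
    show ?C1
    proof (intro allI impI)
      fix i assume i: "1 \<le> i \<and> i \<le> a \<and> i \<le> b"
      then have "Suc (a + b) - ?t + (i - 1) = a + (b - a) + i" "Suc (i - 1) = i" "i - 1 < ?t"
        by (auto simp: min_def)
      then show "e i \<le> e (a + (b - a) + i)" using *[of "i - 1"] by metis
    qed
  next
    assume C1: ?C1
    show "\<forall>j. 1 \<le> j \<and> j \<le> ?t \<longrightarrow> fits j"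
    proof (intro allI impI)
      fix j assume j: "1 \<le> j \<and> j \<le> ?t"
      have "e (Suc i) \<le> e (Suc (a + b) - j + i)" if "i < j" for i
      proof -
        have "e (Suc i) \<le> e (a + (b - a) + Suc i)" using C1[rule_format, of "Suc i"] that j by simp
        also have "\<dots> \<le> e (Suc (a + b) - j + i)"
        proof -
          have eq: "Suc (a + b) - j + i = a + (Suc b - j + i)"
            "a + (b - a) + Suc i = a + ((b - a) + Suc i)" using j by auto
          consider "(b - a) + Suc i = Suc b - j + i" | "(b - a) + Suc i < Suc b - j + i"
            using j that by linarith
          then show ?thesis
          proof cases
            case 1
            then show ?thesis unfolding eq by (simp only: order.refl)
          next
            case 2
            moreover have "Suc b - j + i \<le> b" using that j by linarith
            ultimately have "e (a + ((b - a) + Suc i)) < e (a + (Suc b - j + i))"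
              by (intro inc2) simp_all
            then show ?thesis unfolding eq by (rule less_imp_le)
          qed
        qed
        finally show ?thesis .
      qed
      then show "fits j" using fits_iff[of j] j by simp
    qed
  qed
  finally have B: "?B \<longleftrightarrow> ?C1" .
  have "?S \<longleftrightarrow> ?C2 \<and> ?C3" if C1: ?C1
  proof -
    have "e 1 \<le> e (a + (b - a) + 1)" using C1[rule_format, of 1] a b by simp
    also have "\<dots> \<le> e (a + b)"
    proof (cases "b - a + 1 = b")
      case True
      then have "a + (b - a) + 1 = a + b" by simp
      then show ?thesis by (simp only: order.refl)
    next
      case False
      then have "e (a + ((b - a) + 1)) < e (a + b)" using a b by (intro inc2) auto
      then show ?thesis by (simp add: add.assoc)
    qed
    finally have "e 1 \<le> e (a + b)" .
    from first_row_block2[OF this b order.refl]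
    obtain x y i where xy: "hd (T (a + b)) = [x, y]" "x \<le> e 1" "e 1 \<le> y"
      "a < i" "i \<le> a + b" "y = e i"
      "\<And>i. a < i \<Longrightarrow> i \<le> a + b \<Longrightarrow> e 1 \<le> e i \<Longrightarrow> y \<le> e i"
      by (auto simp: Suc_le_eq)
    have "?S \<longleftrightarrow> (\<forall>k. a + b < k \<and> k \<le> a + b + m \<longrightarrow> (x \<le> w k \<and> y \<le> w k) \<and>
       (\<forall>k'. a + b < k' \<and> k' < k \<longrightarrow> w k' \<le> w k))"
      using new_row_zero_run[of "a + b" "a + b + m" w] a xy(1) by simp
    also have "\<dots> \<longleftrightarrow> (\<forall>k. a + b < k \<and> k \<le> a + b + m \<longrightarrow> y \<le> e k \<and>
       (\<forall>k'. a + b < k' \<and> k' < k \<longrightarrow> e k' \<le> e k))"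
      using xy(2,3) w3 by auto
    also have "\<dots> \<longleftrightarrow> (\<forall>k. a + b < k \<and> k \<le> a + b + m \<longrightarrow> y \<le> e k) \<and> ?C3"
      by auto
    also have "(\<forall>k. a + b < k \<and> k \<le> a + b + m \<longrightarrow> y \<le> e k) \<longleftrightarrow> ?C2"
    proof -
      have "y \<le> e k \<longleftrightarrow> (\<exists>j. 1 \<le> j \<and> j \<le> b \<and> e 1 \<le> e (a + j) \<and> e (a + j) \<le> e k)" for k
      proof
        assume "y \<le> e k"
        then show "\<exists>j. 1 \<le> j \<and> j \<le> b \<and> e 1 \<le> e (a + j) \<and> e (a + j) \<le> e k"
          using xy(3-6) by (intro exI[of _ "i - a"]) auto
      next
        assume "\<exists>j. 1 \<le> j \<and> j \<le> b \<and> e 1 \<le> e (a + j) \<and> e (a + j) \<le> e k"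
        then obtain j where "1 \<le> j" "j \<le> b" "e 1 \<le> e (a + j)" "e (a + j) \<le> e k" by blast
        then show "y \<le> e k" using xy(7)[of "a + j"] by simp
      qed
      then show ?thesis by blast
    qed
    finally show ?thesis .
  qed
  then show ?thesis using split B by blast
qed

end

section \<open>Diagrams as column functions\<close>

text \<open>
  Numbering the nodes of a diagram by rows, node \<open>p\<close> lies in row \<open>rw p\<close> and column \<open>col p\<close>.
  The inversions of \<open>w_diag\<close> are then read off from the columns alone.
\<close>

lemma w_diag_coordinates:
  fixes rw col :: "nat \<Rightarrow> nat"
  assumes lex: "\<And>p q. 1 \<le> p \<Longrightarrow> p < q \<Longrightarrow> q \<le> n \<Longrightarrow> rw p < rw q \<or> (rw p = rw q \<and> col p < col q)"
    and E: "E = (\<lambda>p. (rw p, col p)) ` {1..n}"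
  shows "w_diag E permutes {1..n}"
    and "\<And>p q. 1 \<le> p \<Longrightarrow> p < q \<Longrightarrow> q \<le> n \<Longrightarrow> w_diag E q < w_diag E p \<longleftrightarrow> col q < col p"
proof -
  define nd where "nd p = (rw p, col p)" for p
  have E: "E = nd ` {1..n}" using E by (simp add: nd_def)
  have ne: "nd p \<noteq> nd q" if "p \<in> {1..n}" "q \<in> {1..n}" "p < q" for p q
    using lex[of p q] that by (auto simp: nd_def)
  have inj: "inj_on nd {1..n}"
    by (rule linorder_inj_onI) (use ne in auto)
  have cardE: "card E = n" unfolding E card_image[OF inj] by simp
  have row: "t_row E (nd p) = p" if p: "p \<in> {1..n}" for p
  proof -
    have "(rw q < rw p \<or> rw q = rw p \<and> col q \<le> col p) \<longleftrightarrow> q \<le> p" if "q \<in> {1..n}" for q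
      using lex[of p q] lex[of q p] p that by (cases q p rule: linorder_cases) auto
    then have "{(a', b') \<in> E. a' < rw p \<or> (a' = rw p \<and> b' \<le> col p)} = nd ` {1..p}"
      using p by (force simp: E nd_def)
    moreover have "card (nd ` {1..p}) = p"
      using p by (subst card_image[OF inj_on_subset[OF inj]]) auto
    ultimately show ?thesis by (simp add: t_row_def nd_def)
  qed
  define c where "c p = t_col E (nd p)" for p
  \<comment> \<open>the nodes that come weakly before node \<open>p\<close> in the order by columns\<close>
  define B where "B p = {q \<in> {1..n}. col q < col p \<or> (col q = col p \<and> rw q \<le> rw p)}" for p
  have c: "c p = card (B p)" for p
  proof -
    have "{(a', b') \<in> E. b' < col p \<or> (b' = col p \<and> a' \<le> rw p)} = nd ` B p"
      by (auto simp: E B_def nd_def)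
    moreover have "card (nd ` B p) = card (B p)"
      by (intro card_image inj_on_subset[OF inj]) (auto simp: B_def)
    ultimately show ?thesis by (simp add: c_def t_col_def nd_def)
  qed
  have less: "c q < c p"
    if "q \<in> {1..n}" "p \<in> {1..n}" "col q < col p \<or> (col q = col p \<and> rw q < rw p)" for p q
    unfolding c
  proof (rule psubset_card_mono)
    have "p \<in> B p" "p \<notin> B q" "B q \<subseteq> B p" using that by (auto simp: B_def)
    then show "B q \<subset> B p" by blast
  qed (simp add: B_def)
  have cmp: "if col q < col p then c q < c p else c p < c q" if "1 \<le> p" "p < q" "q \<le> n" for p q
  proof (cases "col q < col p")
    case True
    then show ?thesis using less[of q p] that by simp
  next
    case False
    then have "col p < col q \<or> (col p = col q \<and> rw p < rw q)" using lex[OF that] by linarith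
    then show ?thesis using less[of p q] that False by simp
  qed
  have "inj_on c {1..n}"
    by (rule linorder_inj_onI) (use cmp in \<open>fastforce split: if_splits\<close>)+
  moreover have "c ` {1..n} \<subseteq> {1..n}"
  proof
    fix x assume "x \<in> c ` {1..n}"
    then obtain p where p: "p \<in> {1..n}" "x = card (B p)" using c by auto
    have "B p \<subseteq> {1..n}" "p \<in> B p" using p by (auto simp: B_def)
    then have "card (B p) \<le> card {1..n}" by (intro card_mono) simp_all
    moreover have "card (B p) \<noteq> 0"
      using \<open>p \<in> B p\<close> \<open>B p \<subseteq> {1..n}\<close> by (metis card_0_eq empty_iff finite_atLeastAtMost finite_subset)
    ultimately show "x \<in> {1..n}" using p by simp
  qed
  ultimately have bij: "bij_betw c {1..n} {1..n}"
    by (simp add: bij_betw_def endo_inj_surj)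
  define w where "w p = (if p \<in> {1..n} then c p else p)" for p
  have "bij_betw w {1..n} {1..n}"
    using bij by (subst bij_betw_cong[of _ w c]) (auto simp: w_def)
  then have w: "w permutes {1..n}" by (rule bij_imp_permutes) (auto simp: w_def)
  have "w_diag E = w"
    unfolding w_diag_def cardE
  proof (rule the_equality)
    show "w \<in> carrier (symg n) \<and> (\<forall>x\<in>E. w (t_row E x) = t_col E x)"
      using w row by (auto simp: symg_def E w_def c_def)
  next
    fix v assume v: "v \<in> carrier (symg n) \<and> (\<forall>x\<in>E. v (t_row E x) = t_col E x)"
    then have vp: "v permutes {1..n}" by (simp add: symg_def)
    have "v p = w p" for p
    proof (cases "p \<in> {1..n}")
      case True
      then have "v (t_row E (nd p)) = t_col E (nd p)" using v E by blast
      then show ?thesis using row[OF True] True by (simp add: w_def c_def)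
    next
      case False
      show ?thesis unfolding w_def if_not_P[OF False] using vp False by (rule permutes_not_in)
    qed
    then show "v = w" by (rule ext)
  qed
  then show "w_diag E permutes {1..n}" using w by simp
  fix p q assume pq: "1 \<le> p" "p < q" "q \<le> n"
  then have "w_diag E p = c p" "w_diag E q = c q"
    using \<open>w_diag E = w\<close> by (simp_all add: w_def)
  then show "w_diag E q < w_diag E p \<longleftrightarrow> col q < col p"
    using cmp[OF pq] by (cases "col q < col p") simp_all
qed

lemma increasing_enumeration:
  fixes R :: "nat set"
  assumes "finite R" "card R = k"
  shows "\<exists>f. f ` {1..k} = R \<and> (\<forall>i j. 1 \<le> i \<longrightarrow> i < j \<longrightarrow> j \<le> k \<longrightarrow> f i < f j)"
proof -
  let ?xs = "sorted_list_of_set R"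
  have len: "length ?xs = k" using assms by simp
  have "(\<lambda>i. ?xs ! (i - 1)) ` {1..k} = (\<lambda>i. ?xs ! (i - 1)) ` Suc ` {..<k}"
    unfolding lessThan_atLeast0 image_Suc_atLeastLessThan by (simp add: atLeastLessThanSuc_atLeastAtMost)
  also have "\<dots> = (!) ?xs ` {..<k}"
    unfolding image_image by simp
  also have "\<dots> = set ?xs"
    using nth_image[of k ?xs] len by (simp add: lessThan_atLeast0)
  also have "\<dots> = R" using assms(1) by simp
  finally have "(\<lambda>i. ?xs ! (i - 1)) ` {1..k} = R" .
  moreover have "?xs ! (i - 1) < ?xs ! (j - 1)" if "1 \<le> i" "i < j" "j \<le> k" for i j
    by (rule sorted_wrt_nth_less[OF strict_sorted_list_of_set]) (use that len in simp_all)
  ultimately show ?thesis by (intro exI[of _ "\<lambda>i. ?xs ! (i - 1)"] conjI allI impI)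
qed

text \<open>The row of the \<open>p\<close>-th node in a diagram with row lengths \<open>a, b, 1, 1, \<dots>\<close>.\<close>

definition row_of :: "nat \<Rightarrow> nat \<Rightarrow> nat \<Rightarrow> nat" where
  "row_of a b p = (if p \<le> a then 1 else if p \<le> a + b then 2 else p - (a + b) + 2)"

lemma row_of_mono: "p \<le> q \<Longrightarrow> row_of a b p \<le> row_of a b q"
  by (auto simp: row_of_def)

text \<open>A diagram with these row lengths is given by a column function increasing along the rows.\<close>

lemma diagram_coordinates:
  assumes E: "E \<in> diagrams_of (a # b # replicate m 1)"
  obtains col where "E = (\<lambda>p. (row_of a b p, col p)) ` {1..a + b + m}"
    "\<And>p q. 1 \<le> p \<Longrightarrow> p < q \<Longrightarrow> q \<le> a + b + m \<Longrightarrow> row_of a b p = row_of a b q \<Longrightarrow> col p < col q"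
proof -
  let ?lam = "a # b # replicate m 1"
  let ?R = "\<lambda>k. {x. (k, x) \<in> E}"
  have fin: "finite E" and rows: "fst ` E = {1..m + 2}"
    and cards: "\<And>k. k \<in> {1..m + 2} \<Longrightarrow> card (?R k) = ?lam ! (k - 1)"
    using E by (auto simp: diagrams_of_def diagram_def)
  have "finite (?R k)" for k
    by (rule finite_subset[OF _ finite_imageI[OF fin, of snd]]) force
  then have "\<forall>k. \<exists>f. f ` {1..card (?R k)} = ?R k \<and>
      (\<forall>i j. 1 \<le> i \<longrightarrow> i < j \<longrightarrow> j \<le> card (?R k) \<longrightarrow> f i < f j)"
    using increasing_enumeration by blast
  then obtain f where f: "\<And>k. f k ` {1..card (?R k)} = ?R k"
    "\<And>k i j. 1 \<le> i \<Longrightarrow> i < j \<Longrightarrow> j \<le> card (?R k) \<Longrightarrow> f k i < f k j" by metis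
  have c1: "card (?R 1) = a" and c2: "card (?R 2) = b"
    using cards[of 1] cards[of 2] by simp_all
  have c3: "card (?R k) = 1" if "2 < k" "k \<le> m + 2" for k
    using cards[of k] that by (simp add: nth_Cons' )
  define col where "col p = (if p \<le> a then f 1 p else if p \<le> a + b then f 2 (p - a)
      else f (p - (a + b) + 2) 1)" for p
  have "E = (\<lambda>p. (row_of a b p, col p)) ` {1..a + b + m}"
  proof (intro equalityI subsetI)
    fix z assume z: "z \<in> E"
    obtain k x where kx: "z = (k, x)" by fastforce
    then have x: "x \<in> ?R k" using z by simp
    have "k \<in> fst ` E" using z kx by force
    then have "k = 1 \<or> k = 2 \<or> (2 < k \<and> k \<le> m + 2)" using rows by auto
    then obtain p where "p \<in> {1..a + b + m}" "row_of a b p = k" "col p = x"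
    proof (elim disjE)
      assume k: "k = 1"
      then obtain p where "p \<in> {1..a}" "x = f 1 p"
        using x f(1)[of 1] unfolding c1 by blast
      then show ?thesis using k by (intro that[of p]) (auto simp: row_of_def col_def)
    next
      assume k: "k = 2"
      then obtain p where "p \<in> {1..b}" "x = f 2 p"
        using x f(1)[of 2] unfolding c2 by blast
      then show ?thesis using k by (intro that[of "a + p"]) (auto simp: row_of_def col_def)
    next
      assume k: "2 < k \<and> k \<le> m + 2"
      then have "card (?R k) = 1" by (intro c3) auto
      then have "x = f k 1" using x f(1)[of k] by auto
      moreover have "Suc (Suc (k - 2)) = k" using k by linarith
      ultimately show ?thesis
        using k by (intro that[of "a + b + (k - 2)"]) (auto simp: row_of_def col_def)
    qed
    then show "z \<in> (\<lambda>p. (row_of a b p, col p)) ` {1..a + b + m}" using kx by force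
  next
    fix z assume "z \<in> (\<lambda>p. (row_of a b p, col p)) ` {1..a + b + m}"
    then obtain p where p: "1 \<le> p" "p \<le> a + b + m" "z = (row_of a b p, col p)" by auto
    have "col p \<in> ?R (row_of a b p)"
    proof -
      consider "p \<le> a" | "a < p" "p \<le> a + b" | "a + b < p" by linarith
      then show ?thesis
      proof cases
        case 1
        then have "f 1 p \<in> f 1 ` {1..card (?R 1)}" using c1 p by simp
        then show ?thesis using 1 f(1)[of 1] by (simp add: row_of_def col_def)
      next
        case 2
        then have "p - a \<in> {1..card (?R 2)}" using c2 by auto
        then have "f 2 (p - a) \<in> f 2 ` {1..card (?R 2)}" by (rule imageI)
        then show ?thesis using 2 f(1)[of 2] by (simp add: row_of_def col_def)
      next
        case 3
        define k where "k = p - (a + b) + 2"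
        have "card (?R k) = 1" using c3[of k] 3 p by (simp add: k_def)
        then have "f k 1 \<in> f k ` {1..card (?R k)}" by simp
        then show ?thesis using 3 f(1)[of k] by (simp add: row_of_def col_def k_def)
      qed
    qed
    then show "z \<in> E" using p by simp
  qed
  moreover have "col p < col q"
    if "1 \<le> p" "p < q" "q \<le> a + b + m" "row_of a b p = row_of a b q" for p q
  proof -
    have "q \<le> a \<or> (a < p \<and> q \<le> a + b)" using that by (auto simp: row_of_def split: if_splits)
    then show ?thesis
      using that f(2)[of p q 1] f(2)[of "p - a" "q - a" 2] c1 c2 by (auto simp: col_def)
  qed
  ultimately show ?thesis using that by blast
qed

section \<open>The candidate diagrams\<close>

text \<open>
  The column of the \<open>p\<close>-th node of \<open>D\<^sub>u\<close>. The subtraction \<open>b - a\<close> is truncated, so for \<open>a \<ge> b\<close> the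
  first row starts at column \<open>u = 1\<close> and is full.
\<close>

definition col_of :: "nat \<Rightarrow> nat \<Rightarrow> nat \<Rightarrow> nat \<Rightarrow> nat" where
  "col_of a b u p = (if p = 1 then u else if p \<le> a then b - a + p else if p \<le> a + b then p - a else u)"

text \<open>The diagram \<open>D\<^sub>u\<close>; it is used for \<open>1 \<le> u \<le> b - a + 1\<close>.\<close>

definition hook_diagram :: "nat \<Rightarrow> nat \<Rightarrow> nat \<Rightarrow> nat \<Rightarrow> (nat \<times> nat) set" where
  "hook_diagram a b m u = (\<lambda>p. (row_of a b p, col_of a b u p)) ` {1..a + b + m}"

lemma hook_diagram_eq:
  assumes "1 \<le> a" "1 \<le> b"
  shows "hook_diagram a b m u = {(1, u)} \<union> {(1, b - a + i) | i. 2 \<le> i \<and> i \<le> a}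
    \<union> {(2, j) | j. 1 \<le> j \<and> j \<le> b} \<union> {(i, u) | i. 3 \<le> i \<and> i \<le> m + 2}" (is "_ = ?D")
proof (intro equalityI subsetI)
  fix z assume "z \<in> hook_diagram a b m u"
  then obtain p where "1 \<le> p" "p \<le> a + b + m" "z = (row_of a b p, col_of a b u p)"
    by (auto simp: hook_diagram_def)
  then show "z \<in> ?D" using assms by (auto simp: row_of_def col_of_def)
next
  fix z assume "z \<in> ?D"
  then consider "z = (1, u)" | i where "z = (1, b - a + i)" "2 \<le> i" "i \<le> a"
    | j where "z = (2, j)" "1 \<le> j" "j \<le> b" | i where "z = (i, u)" "3 \<le> i" "i \<le> m + 2"
    by blast
  then have "\<exists>p. 1 \<le> p \<and> p \<le> a + b + m \<and> z = (row_of a b p, col_of a b u p)"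
  proof cases
    case 1
    then show ?thesis using assms by (intro exI[of _ 1]) (auto simp: row_of_def col_of_def)
  next
    case (2 i)
    then show ?thesis using assms by (intro exI[of _ i]) (auto simp: row_of_def col_of_def)
  next
    case (3 j)
    then show ?thesis using assms by (intro exI[of _ "a + j"]) (auto simp: row_of_def col_of_def)
  next
    case (4 i)
    then show ?thesis using assms
      by (intro exI[of _ "a + b + (i - 2)"]) (auto simp: row_of_def col_of_def)
  qed
  then show "z \<in> hook_diagram a b m u" by (auto simp: hook_diagram_def)
qed

lemma col_of_increasing:
  assumes "1 \<le> a" "1 \<le> b" "u \<le> b - a + 1" "1 \<le> p" "p < q" "row_of a b p = row_of a b q"
  shows "col_of a b u p < col_of a b u q"
proof -
  have "q \<le> a \<or> (a < p \<and> q \<le> a + b)" using assms by (auto simp: row_of_def split: if_splits)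
  then show ?thesis using assms by (auto simp: col_of_def)
qed

lemma columns_hook_diagram:
  assumes "1 \<le> a" "1 \<le> b" "1 \<le> u" "u \<le> b - a + 1"
  shows "snd ` hook_diagram a b m u = {1..max a b}"
proof (intro equalityI subsetI)
  fix x assume "x \<in> snd ` hook_diagram a b m u"
  then show "x \<in> {1..max a b}"
    using assms by (auto simp: hook_diagram_eq[OF assms(1,2)])
next
  fix x assume x: "x \<in> {1..max a b}"
  have "\<exists>k. (k, x) \<in> hook_diagram a b m u"
  proof (cases "x \<le> b")
    case True
    then have "(2, x) \<in> hook_diagram a b m u" using x by (auto simp: hook_diagram_eq[OF assms(1,2)])
    then show ?thesis by blast
  next
    case False
    then have "(1, x) \<in> hook_diagram a b m u"
      using x assms by (auto simp: hook_diagram_eq[OF assms(1,2)])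
    then show ?thesis by blast
  qed
  then show "x \<in> snd ` hook_diagram a b m u" by force
qed

lemma hook_diagram_in_diagrams_of:
  assumes "1 \<le> a" "1 \<le> b" "1 \<le> u" "u \<le> b - a + 1"
  shows "hook_diagram a b m u \<in> diagrams_of (a # b # replicate m 1)"
proof -
  let ?D = "hook_diagram a b m u" and ?lam = "a # b # replicate m 1"
  note eq = hook_diagram_eq[OF assms(1,2)]
  have rows: "fst ` ?D = {1..m + 2}"
  proof (intro equalityI subsetI)
    fix k assume k: "k \<in> {1..m + 2}"
    consider "k = 1" | "k = 2" | "3 \<le> k" "k \<le> m + 2"
      using k unfolding atLeastAtMost_iff by linarith
    then have "\<exists>x. (k, x) \<in> ?D"
    proof cases
      case 1
      then show ?thesis by (intro exI[of _ u]) (simp add: eq)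
    next
      case 2
      then show ?thesis using assms(2) by (intro exI[of _ 1]) (simp add: eq)
    next
      case 3
      then show ?thesis by (intro exI[of _ u]) (simp add: eq)
    qed
    then show "k \<in> fst ` ?D" by force
  qed (auto simp: eq)
  have "card {x. (k, x) \<in> ?D} = ?lam ! (k - 1)" if k: "k \<in> {1..m + 2}" for k
  proof -
    consider "k = 1" | "k = 2" | "3 \<le> k" using k unfolding atLeastAtMost_iff by linarith
    then show ?thesis
    proof cases
      case 1
      have "(1, x) \<in> ?D \<longleftrightarrow> x \<in> col_of a b u ` {1..a}" for x
      proof
        assume "(1, x) \<in> ?D"
        then obtain p where p: "p \<in> {1..a + b + m}" "row_of a b p = 1" "x = col_of a b u p"
          unfolding hook_diagram_def by (elim imageE) (simp only: prod.inject)
        have "p \<le> a"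
        proof (rule ccontr)
          assume "\<not> p \<le> a"
          then have "2 \<le> row_of a b p" by (simp add: row_of_def)
          then show False using p(2) by simp
        qed
        then have "p \<in> {1..a}" using p(1) by simp
        then show "x \<in> col_of a b u ` {1..a}" using p(3) by blast
      next
        assume "x \<in> col_of a b u ` {1..a}"
        then obtain p where p: "p \<in> {1..a}" "x = col_of a b u p" by blast
        then have "(1, x) = (row_of a b p, col_of a b u p)" "p \<in> {1..a + b + m}"
          by (simp_all add: row_of_def)
        then show "(1, x) \<in> ?D"
          unfolding hook_diagram_def by (rule image_eqI)
      qed
      then have "{x. (1, x) \<in> ?D} = col_of a b u ` {1..a}" by blast
      moreover have "inj_on (col_of a b u) {1..a}"
      proof (rule linorder_inj_onI)
        fix p q assume "p < q" "p \<in> {1..a}" "q \<in> {1..a}"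
        then show "col_of a b u p \<noteq> col_of a b u q"
          using col_of_increasing[OF assms(1,2,4), of p q] by (simp add: row_of_def)
      qed auto
      ultimately show ?thesis using 1 by (simp add: card_image)
    next
      case 2
      have "{x. (2, x) \<in> ?D} = {1..b}" by (auto simp: eq)
      then show ?thesis using 2 by simp
    next
      case 3
      then have "(k, x) \<in> ?D \<longleftrightarrow> x = u" for x using k by (simp add: eq)
      then have "{x. (k, x) \<in> ?D} = {u}" by simp
      then show ?thesis using 3 k by (simp add: nth_Cons')
    qed
  qed
  moreover have "diagram ?D"
    unfolding diagram_def
  proof (intro conjI)
    show "finite ?D" by (simp add: hook_diagram_def)
    show "?D \<noteq> {}" using assms by (auto simp: eq)
    show "\<exists>r. fst ` ?D = {1..r}" using rows by blast
    show "\<exists>c. snd ` ?D = {1..c}" using columns_hook_diagram[OF assms] by blast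
  qed
  ultimately show ?thesis using rows by (simp add: diagrams_of_def)
qed

lemma w_hook_diagram:
  assumes "1 \<le> a" "1 \<le> b" "u \<le> b - a + 1"
  shows "w_diag (hook_diagram a b m u) permutes {1..a + b + m}"
    and "\<And>p q. 1 \<le> p \<Longrightarrow> p < q \<Longrightarrow> q \<le> a + b + m \<Longrightarrow>
      w_diag (hook_diagram a b m u) q < w_diag (hook_diagram a b m u) p \<longleftrightarrow>
      col_of a b u q < col_of a b u p"
proof -
  have lex: "row_of a b p < row_of a b q \<or> (row_of a b p = row_of a b q \<and> col_of a b u p < col_of a b u q)"
    if "1 \<le> p" "p < q" "q \<le> a + b + m" for p q
    using that row_of_mono[of p q a b] col_of_increasing[OF assms, of p q] by (auto simp: le_less)
  show "w_diag (hook_diagram a b m u) permutes {1..a + b + m}"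
    using lex hook_diagram_def by (rule w_diag_coordinates(1))
  show "\<And>p q. 1 \<le> p \<Longrightarrow> p < q \<Longrightarrow> q \<le> a + b + m \<Longrightarrow>
      w_diag (hook_diagram a b m u) q < w_diag (hook_diagram a b m u) p \<longleftrightarrow>
      col_of a b u q < col_of a b u p"
    by (rule w_diag_coordinates(2)[OF lex hook_diagram_def])
qed

text \<open>A strictly increasing map of \<open>{1..k}\<close> into itself is the identity.\<close>

lemma increasing_self_map:
  fixes f :: "nat \<Rightarrow> nat"
  assumes "\<And>i j. 1 \<le> i \<Longrightarrow> i < j \<Longrightarrow> j \<le> k \<Longrightarrow> f i < f j" "1 \<le> f 1" "f k \<le> k" "1 \<le> i" "i \<le> k"
  shows "f i = i"
proof -
  have "j \<le> f j" if "1 \<le> j" "j \<le> k" for j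
    using that
  proof (induction j rule: nat_induct_at_least)
    case base
    show ?case using assms(2) .
  next
    case (Suc j)
    then show ?case using assms(1)[of j "Suc j"] by simp
  qed
  moreover have "f (k - j) \<le> k - j" if "j < k" for j
    using that
  proof (induction j)
    case 0
    then show ?case using assms(3) by simp
  next
    case (Suc j)
    then have "f (k - Suc j) < f (k - j)" by (intro assms(1)) auto
    then show ?case using Suc by simp
  qed
  from this[of "k - i"] have "f i \<le> i" using assms(4,5) by simp
  ultimately show ?thesis using assms(4,5) by (simp add: le_antisym)
qed

text \<open>
  A diagram with the permutation of \<open>D\<^sub>u\<close> has at least as many columns, since its rows of lengths
  \<open>a\<close> and \<open>b\<close> need them. With equally many columns, the longer of these two rows is full, and the
  inversions against that row fix the columns of all other nodes.
\<close>

lemma hook_diagram_minimal: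
  assumes "1 \<le> a" "1 \<le> b" "1 \<le> u" "u \<le> b - a + 1"
    and E: "E \<in> diagrams_of (a # b # replicate m 1)"
    and w: "w_diag E = w_diag (hook_diagram a b m u)"
  shows "max a b \<le> card (snd ` E)"
    and "card (snd ` E) \<le> max a b \<Longrightarrow> E = hook_diagram a b m u"
proof -
  let ?n = "a + b + m"
  obtain col where EE: "E = (\<lambda>p. (row_of a b p, col p)) ` {1..?n}"
    and inc: "\<And>p q. 1 \<le> p \<Longrightarrow> p < q \<Longrightarrow> q \<le> ?n \<Longrightarrow> row_of a b p = row_of a b q \<Longrightarrow> col p < col q"
    using diagram_coordinates[OF E] by blast
  define N where "N = card (snd ` E)"
  have snd: "snd ` E = col ` {1..?n}" unfolding EE image_image snd_conv ..
  obtain c where "snd ` E = {1..c}" using E by (auto simp: diagrams_of_def diagram_def)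
  then have colN: "col ` {1..?n} = {1..N}" using snd by (simp add: N_def)
  have rng: "1 \<le> col p" "col p \<le> N" if "1 \<le> p" "p \<le> ?n" for p
    using colN that by (metis atLeastAtMost_iff imageI)+
  have inc1: "col i < col j" if "1 \<le> i" "i < j" "j \<le> a" for i j
    using that by (intro inc) (auto simp: row_of_def)
  have inc2: "col (a + i) < col (a + j)" if "1 \<le> i" "i < j" "j \<le> b" for i j
    using that by (intro inc) (auto simp: row_of_def)
  have "a \<le> N"
  proof -
    have "inj_on col {1..a}" by (rule linorder_inj_onI) (use inc1 in force)+
    moreover have "col ` {1..a} \<subseteq> {1..N}" using colN by auto
    ultimately show ?thesis using card_inj_on_le[of col "{1..a}" "{1..N}"] by simp
  qed
  moreover have "b \<le> N"
  proof -
    have "inj_on (\<lambda>j. col (a + j)) {1..b}" by (rule linorder_inj_onI) (use inc2 in force)+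
    moreover have "(\<lambda>j. col (a + j)) ` {1..b} \<subseteq> {1..N}" using rng by auto
    ultimately show ?thesis using card_inj_on_le[of "\<lambda>j. col (a + j)" "{1..b}" "{1..N}"] by simp
  qed
  ultimately show "max a b \<le> card (snd ` E)" by (simp add: N_def)
  have lex: "row_of a b p < row_of a b q \<or> (row_of a b p = row_of a b q \<and> col p < col q)"
    if "1 \<le> p" "p < q" "q \<le> ?n" for p q
    using that row_of_mono[of p q a b] inc[of p q] by (auto simp: le_less)
  have cmp: "col q < col p \<longleftrightarrow> col_of a b u q < col_of a b u p" if "1 \<le> p" "p < q" "q \<le> ?n" for p q
    using w_diag_coordinates(2)[OF lex EE that] w_hook_diagram(2)[OF assms(1,2,4) that] w by simp
  assume "card (snd ` E) \<le> max a b"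
  then have N: "N \<le> max a b" by (simp add: N_def)
  have "col p = col_of a b u p" if p: "1 \<le> p" "p \<le> ?n" for p
  proof (cases "a \<le> b")
    case True
    have row2: "col (a + j) = j" if "1 \<le> j" "j \<le> b" for j
      using inc2 rng(1)[of "a + 1"] rng(2)[of "a + b"] N True assms(1,2) that
      by (intro increasing_self_map[of b "\<lambda>j. col (a + j)"]) (auto simp: max_def)
    consider "p \<le> a" | "a < p" "p \<le> a + b" | "a + b < p" by linarith
    then show ?thesis
    proof cases
      case 1
      define v where "v = col_of a b u p"
      have v: "1 \<le> v" "v \<le> b" using 1 p True assms by (auto simp: v_def col_of_def)
      have at: "col_of a b u (a + j) = j" if "1 \<le> j" "j \<le> b" for j
        using that assms(1) by (auto simp: col_of_def)
      have "\<not> v < col p"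
        using cmp[of p "a + v"] row2[OF v] at[OF v] 1 p v by (simp add: v_def)
      moreover have "v \<le> col p"
      proof (cases "v = 1")
        case True
        then show ?thesis using rng(1)[OF p] by simp
      next
        case False
        then have v': "1 \<le> v - 1" "v - 1 \<le> b" "v - 1 < v" using v by auto
        have "col (a + (v - 1)) < col p"
          using cmp[of p "a + (v - 1)"] at[OF v'(1,2)] v' 1 p assms(1) by (simp add: v_def)
        then show ?thesis using row2[OF v'(1,2)] by simp
      qed
      ultimately show ?thesis by (simp add: v_def)
    next
      case 2
      then show ?thesis using row2[of "p - a"] assms(1) by (auto simp: col_of_def)
    next
      case 3
      have u: "u \<le> b" using assms True by simp
      have at: "col_of a b u p = u" "\<And>j. 1 \<le> j \<Longrightarrow> j \<le> b \<Longrightarrow> col_of a b u (a + j) = j"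
        using 3 assms(1) by (auto simp: col_of_def)
      have "\<not> col p < u"
        using cmp[of "a + u" p] row2[of u] at(1) at(2)[of u] u assms(3) 3 p by simp
      moreover have "\<not> u < col p"
      proof (cases "u = b")
        case False
        then have u': "1 \<le> Suc u" "Suc u \<le> b" using u by auto
        have "col p < col (a + Suc u)" using cmp[of "a + Suc u" p] at(1) at(2)[OF u'] u' 3 p by simp
        then show ?thesis using row2[OF u'] by simp
      next
        case True
        then show ?thesis using rng(2)[OF p] N \<open>a \<le> b\<close> by simp
      qed
      ultimately show ?thesis using at by simp
    qed
  next
    case False
    then have u: "u = 1" and ba: "b - a = 0" using assms(3,4) by auto
    have row1: "col i = i" if "1 \<le> i" "i \<le> a" for i
      using inc1 rng(1)[of 1] rng(2)[of a] N False assms(1,2) that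
      by (intro increasing_self_map[of a col]) (auto simp: max_def)
    have at: "col_of a b u i = i" if "1 \<le> i" "i \<le> a" for i
      using that u ba by (auto simp: col_of_def)
    show ?thesis
    proof (cases "p \<le> a")
      case True
      then show ?thesis using row1[of p] at[of p] p by simp
    next
      case pa: False
      define v where "v = col_of a b u p"
      have v: "1 \<le> v" "v < a" using pa p u False assms(1,2) by (auto simp: v_def col_of_def)
      have "\<not> col p < v" using cmp[of v p] row1[of v] at[of v] v pa p by (simp add: v_def)
      moreover have "col p < Suc v"
        using cmp[of "Suc v" p] row1[of "Suc v"] at[of "Suc v"] v pa p by (simp add: v_def)
      ultimately show ?thesis by (simp add: v_def)
    qed
  qed
  then show "E = hook_diagram a b m u"
    unfolding EE hook_diagram_def by (intro image_cong) auto
qed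

lemma min_diagram_hook_diagram:
  assumes "1 \<le> a" "1 \<le> b" "1 \<le> u" "u \<le> b - a + 1"
  shows "min_diagram (w_diag (hook_diagram a b m u)) (a # b # replicate m 1) = hook_diagram a b m u"
  unfolding min_diagram_def
proof (rule the_equality)
  let ?D = "hook_diagram a b m u" and ?lam = "a # b # replicate m 1"
  have card: "card (snd ` ?D) = max a b" using columns_hook_diagram[OF assms] by simp
  note D = hook_diagram_in_diagrams_of[OF assms]
  show "is_arg_min (\<lambda>E. card (snd ` E)) (\<lambda>E. E \<in> diagrams_of ?lam \<and> w_diag E = w_diag ?D) ?D"
    using D hook_diagram_minimal(1)[OF assms] card by (auto simp: is_arg_min_def not_less)
  fix E assume "is_arg_min (\<lambda>E. card (snd ` E)) (\<lambda>E. E \<in> diagrams_of ?lam \<and> w_diag E = w_diag ?D) E"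
  then have "E \<in> diagrams_of ?lam" "w_diag E = w_diag ?D" "card (snd ` E) \<le> max a b"
    using D card by (auto simp: is_arg_min_def not_less)
  then show "E = ?D" using hook_diagram_minimal(2)[OF assms] by blast
qed

section \<open>The set Z and its maximal elements\<close>

lemma breaks_eq: "breaks (a # b # replicate m 1) = insert a {a + b..<a + b + m}"
proof (intro equalityI subsetI)
  fix x assume "x \<in> breaks (a # b # replicate m 1)"
  then obtain k where k: "1 \<le> k" "k < m + 2" "x = sum_list (take k (a # b # replicate m 1))"
    by (auto simp: breaks_def)
  show "x \<in> insert a {a + b..<a + b + m}"
  proof (cases "k = 1")
    case True
    then show ?thesis using k by simp
  next
    case False
    define j where "j = k - 2"
    have "k = Suc (Suc j)" "j < m" using False k by (simp_all add: j_def)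
    then show ?thesis using k by (simp add: sum_list_replicate)
  qed
next
  fix x assume "x \<in> insert a {a + b..<a + b + m}"
  then consider "x = a" | j where "x = a + b + j" "j < m" by (auto simp: le_iff_add)
  then show "x \<in> breaks (a # b # replicate m 1)"
  proof cases
    case 1
    then show ?thesis by (auto simp: breaks_def intro!: exI[of _ "1 :: nat"])
  next
    case (2 j)
    then show ?thesis
      by (auto simp: breaks_def sum_list_replicate intro!: exI[of _ "Suc (Suc j)"])
  qed
qed

lemma block_rev_block_rev: "block_rev a b (block_rev a b k) = k"
  by (auto simp: block_rev_def)

lemma w_J_block_rev: "w_J (a # b # replicate m 1) = block_rev a b"
proof (rule w_J_eqI)
  let ?lam = "a # b # replicate m (1 :: nat)"
  have n: "sum_list ?lam = a + b + m" by (simp add: sum_list_replicate)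
  have "bij (block_rev a b)" by (rule involuntory_imp_bij) (rule block_rev_block_rev)
  then have "block_rev a b permutes {1..a + b + m}"
    by (auto simp: permutes_def block_rev_def bij_iff)
  moreover have "block_rev a b p \<le> k \<longleftrightarrow> p \<le> k" if "k \<in> breaks ?lam" for k p
    using that unfolding breaks_eq by (auto simp: block_rev_def)
  ultimately show "block_rev a b \<in> young (sum_list ?lam) (breaks ?lam)"
    unfolding young_def n by blast
  fix p q
  assume pq: "1 \<le> p" "p < q" "q \<le> sum_list ?lam" "\<forall>k\<in>breaks ?lam. \<not> (p \<le> k \<and> k < q)"
  have "q \<le> a \<or> a < p"
    using pq(4) unfolding breaks_eq by auto
  moreover have "q \<le> a + b"
  proof (rule ccontr)
    assume "\<not> q \<le> a + b"
    then have "p \<le> q - 1" "q - 1 < q" "q - 1 \<in> breaks ?lam"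
      using pq(2,3) unfolding n breaks_eq by auto
    then show False using pq(4) by blast
  qed
  ultimately show "block_rev a b q < block_rev a b p"
    using pq(1,2) by (auto simp: block_rev_def)
qed

lemma X_J_iff:
  assumes "1 \<le> a" "1 \<le> b"
  shows "e \<in> X_J (a # b # replicate m 1) \<longleftrightarrow> e permutes {1..a + b + m} \<and> two_blocks a b e"
proof -
  let ?lam = "a # b # replicate m (1 :: nat)"
  have n: "sum_list ?lam = a + b + m" by (simp add: sum_list_replicate)
  have idx: "1 \<le> i \<and> i < a + b + m \<and> i \<notin> insert a {a + b..<a + b + m} \<longleftrightarrow>
      1 \<le> i \<and> (i < a \<or> (a < i \<and> i < a + b))" for i
    by auto
  have run: "e i < e j"
    if "\<And>i. l \<le> i \<Longrightarrow> i < h \<Longrightarrow> e i < e (Suc i)" "l \<le> i" "i < j" "j \<le> h" for l h i j :: nat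
    using that(3,4)
  proof (induction j)
    case (Suc j)
    then show ?case using that(1)[of j] that(2) by (cases "i = j") force+
  qed simp
  have "(\<forall>i. 1 \<le> i \<and> (i < a \<or> (a < i \<and> i < a + b)) \<longrightarrow> e i < e (Suc i)) \<longleftrightarrow> two_blocks a b e"
  proof
    assume adj: "\<forall>i. 1 \<le> i \<and> (i < a \<or> (a < i \<and> i < a + b)) \<longrightarrow> e i < e (Suc i)"
    show "two_blocks a b e"
    proof
      show "e i < e j" if "1 \<le> i" "i < j" "j \<le> a" for i j
        by (rule run[of 1 a]) (use that adj in simp_all)
      show "e (a + i) < e (a + j)" if "1 \<le> i" "i < j" "j \<le> b" for i j
        by (rule run[of "Suc a" "a + b"]) (use that adj in simp_all)
    qed (use assms in auto)
  next
    assume "two_blocks a b e"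
    then interpret two_blocks a b m e .
    show "\<forall>i. 1 \<le> i \<and> (i < a \<or> (a < i \<and> i < a + b)) \<longrightarrow> e i < e (Suc i)"
    proof (intro allI impI)
      fix i assume i: "1 \<le> i \<and> (i < a \<or> (a < i \<and> i < a + b))"
      show "e i < e (Suc i)"
      proof (cases "i < a")
        case True
        then show ?thesis using inc1[of i "Suc i"] i by simp
      next
        case False
        then have "1 \<le> i - a" "Suc (i - a) \<le> b" using i by linarith+
        then have "e (a + (i - a)) < e (a + Suc (i - a))" by (intro inc2) simp_all
        then show ?thesis using False i by simp
      qed
    qed
  qed
  then show ?thesis
    unfolding X_J_eq breaks_eq n mem_Collect_eq idx by blast
qed

lemma Z_set_iff:
  assumes "1 \<le> a" "1 \<le> b"
  shows "e \<in> Z_set (a # b # replicate m 1) \<longleftrightarrow>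
    e permutes {1..a + b + m} \<and> two_blocks a b e \<and>
    (\<forall>i. 1 \<le> i \<and> i \<le> a \<and> i \<le> b \<longrightarrow> e i \<le> e (a + (b - a) + i)) \<and>
    (\<forall>k. a + b < k \<and> k \<le> a + b + m \<longrightarrow> (\<exists>j. 1 \<le> j \<and> j \<le> b \<and> e 1 \<le> e (a + j) \<and> e (a + j) \<le> e k)) \<and>
    (\<forall>k k'. a + b < k' \<and> k' < k \<and> k \<le> a + b + m \<longrightarrow> e k' \<le> e k)"
proof -
  let ?lam = "a # b # replicate m (1 :: nat)"
  have n: "sum_list ?lam = a + b + m" by (simp add: sum_list_replicate)
  interpret id: two_blocks a b m id
    by standard (use assms in auto)
  have std_id: "id.standard_rows"
    unfolding id.standard_rows_iff
  proof (intro conjI allI impI)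
    fix k assume "a + b < k \<and> k \<le> a + b + m"
    then show "\<exists>j. 1 \<le> j \<and> j \<le> b \<and> id 1 \<le> id (a + j) \<and> id (a + j) \<le> id k"
      using assms by (intro exI[of _ 1]) auto
  qed auto
  have id_w: "id.w = block_rev a b" by (simp add: id.w_def)
  have "right_cell_equiv (a + b + m) (block_rev a b \<otimes>\<^bsub>symg (a + b + m)\<^esub> e) (block_rev a b) \<longleftrightarrow>
      two_blocks.standard_rows a b m e" if "two_blocks a b e"
  proof -
    interpret two_blocks a b m e by (fact that)
    have "right_cell_equiv (a + b + m) (block_rev a b \<otimes>\<^bsub>symg (a + b + m)\<^esub> e) (block_rev a b) \<longleftrightarrow>
        (\<forall>k. 1 \<le> k \<and> k \<le> a + b + m \<longrightarrow> new_row w k = new_row id.w k)"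
      unfolding right_cell_equiv_def symg_mult recording_tableau_eq_iff id_w w_def ..
    also have "\<dots> \<longleftrightarrow> standard_rows"
      using std_id unfolding standard_rows_def id.standard_rows_def by simp
    finally show ?thesis .
  qed
  moreover have "two_blocks.standard_rows a b m e \<longleftrightarrow>
    (\<forall>i. 1 \<le> i \<and> i \<le> a \<and> i \<le> b \<longrightarrow> e i \<le> e (a + (b - a) + i)) \<and>
    (\<forall>k. a + b < k \<and> k \<le> a + b + m \<longrightarrow> (\<exists>j. 1 \<le> j \<and> j \<le> b \<and> e 1 \<le> e (a + j) \<and> e (a + j) \<le> e k)) \<and>
    (\<forall>k k'. a + b < k' \<and> k' < k \<and> k \<le> a + b + m \<longrightarrow> e k' \<le> e k)" if "two_blocks a b e"
    using that by (rule two_blocks.standard_rows_iff)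
  ultimately show ?thesis
    unfolding Z_set_def mem_Collect_eq n w_J_block_rev X_J_iff[OF assms] by blast
qed

lemma w_hook_diagram_in_Z:
  assumes ab: "1 \<le> a" "1 \<le> b" and u: "1 \<le> u" "u \<le> b - a + 1"
  shows "w_diag (hook_diagram a b m u) \<in> Z_set (a # b # replicate m 1)"
proof -
  define d where "d = w_diag (hook_diagram a b m u)"
  let ?c = "col_of a b u"
  note d = w_hook_diagram[where m = m, OF ab u(2), folded d_def]
  have lt: "d p < d q" if "1 \<le> p" "p < q" "q \<le> a + b + m" "?c p \<le> ?c q" for p q
  proof -
    have "d p \<noteq> d q" using permutes_inj[OF d(1)] that(2) by (simp add: inj_eq)
    then show ?thesis using d(2)[OF that(1-3)] that(4) by simp
  qed
  have "two_blocks a b d"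
  proof
    show "d i < d j" if "1 \<le> i" "i < j" "j \<le> a" for i j
      using that col_of_increasing[OF ab u(2), of i j] by (intro lt) (auto simp: row_of_def)
    show "d (a + i) < d (a + j)" if "1 \<le> i" "i < j" "j \<le> b" for i j
      using that col_of_increasing[OF ab u(2), of "a + i" "a + j"] by (intro lt) (auto simp: row_of_def)
  qed (use ab in auto)
  moreover have "d i \<le> d (a + (b - a) + i)" if "1 \<le> i \<and> i \<le> a \<and> i \<le> b" for i
  proof -
    have "a + (b - a) + i \<le> a + b" "\<not> a + (b - a) + i \<le> a" using that by auto
    then have "?c i \<le> ?c (a + (b - a) + i)"
      using that ab u by (auto simp: col_of_def)
    moreover have "1 \<le> i" "i < a + (b - a) + i" "a + (b - a) + i \<le> a + b + m"
      using that ab \<open>a + (b - a) + i \<le> a + b\<close> by linarith+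
    ultimately show ?thesis by (intro less_imp_le[OF lt])
  qed
  moreover have "\<exists>j. 1 \<le> j \<and> j \<le> b \<and> d 1 \<le> d (a + j) \<and> d (a + j) \<le> d k"
    if "a + b < k \<and> k \<le> a + b + m" for k
  proof (intro exI conjI)
    show "1 \<le> u" by (fact u(1))
    show "u \<le> b" using u ab by auto
    then have c: "?c 1 = u" "?c (a + u) = u" "?c k = u"
      using that ab u by (auto simp: col_of_def)
    show "d 1 \<le> d (a + u)"
      by (rule less_imp_le, rule lt) (use c \<open>u \<le> b\<close> ab u in auto)
    show "d (a + u) \<le> d k"
      by (rule less_imp_le, rule lt) (use c \<open>u \<le> b\<close> ab u that in auto)
  qed
  moreover have "d k' \<le> d k" if "a + b < k' \<and> k' < k \<and> k \<le> a + b + m" for k k'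
    by (rule less_imp_le, rule lt) (use that ab in \<open>auto simp: col_of_def\<close>)
  ultimately show ?thesis
    unfolding d_def[symmetric] Z_set_iff[OF ab] using d(1) by blast
qed

text \<open>
  Here \<open>u\<close> is the least index for which the \<open>u\<close>-th value on the second block exceeds \<open>e 1\<close>.
\<close>

lemma Z_below_hook_diagram:
  assumes ab: "1 \<le> a" "1 \<le> b" and e: "e \<in> Z_set (a # b # replicate m 1)"
  shows "\<exists>u. 1 \<le> u \<and> u \<le> b - a + 1 \<and> Inv e \<subseteq> Inv (w_diag (hook_diagram a b m u))"
proof -
  have perm: "e permutes {1..a + b + m}" and "two_blocks a b e"
    and C1: "\<And>i. 1 \<le> i \<Longrightarrow> i \<le> a \<Longrightarrow> i \<le> b \<Longrightarrow> e i \<le> e (a + (b - a) + i)"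
    and C2: "\<And>k. a + b < k \<Longrightarrow> k \<le> a + b + m \<Longrightarrow>
      \<exists>j. 1 \<le> j \<and> j \<le> b \<and> e 1 \<le> e (a + j) \<and> e (a + j) \<le> e k"
    and C3: "\<And>k k'. a + b < k' \<Longrightarrow> k' < k \<Longrightarrow> k \<le> a + b + m \<Longrightarrow> e k' \<le> e k"
    using e unfolding Z_set_iff[OF ab] by blast+
  interpret two_blocks a b m e by fact
  have inc2': "e (a + i) \<le> e (a + j)" if "1 \<le> i" "i \<le> j" "j \<le> b" for i j
    using inc2[of i j] that by (cases "i = j") auto
  define u where "u = (LEAST j. 1 \<le> j \<and> e 1 \<le> e (a + j))"
  have ex: "1 \<le> b - a + 1 \<and> e 1 \<le> e (a + (b - a + 1))"
    using C1[of 1] ab by (simp add: add.assoc)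
  have u: "1 \<le> u" "e 1 \<le> e (a + u)"
    using LeastI[of "\<lambda>j. 1 \<le> j \<and> e 1 \<le> e (a + j)", OF ex] by (auto simp: u_def)
  have uba: "u \<le> b - a + 1" unfolding u_def using ex by (rule Least_le)
  have least: "u \<le> j" if "1 \<le> j" "e 1 \<le> e (a + j)" for j
    unfolding u_def using that by (intro Least_le) simp
  have ub: "u \<le> b" using uba ab by auto
  have uk: "e (a + u) \<le> e k" if k: "a + b < k" "k \<le> a + b + m" for k
  proof -
    obtain j where j: "1 \<le> j" "j \<le> b" "e 1 \<le> e (a + j)" "e (a + j) \<le> e k" using C2[OF k] by blast
    then show ?thesis using inc2'[of u j] least[of j] u by simp
  qed
  let ?c = "col_of a b u"
  have key: "?c q < ?c p" if pq: "1 \<le> p" "p < q" "q \<le> a + b + m" "e q < e p" for p q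
  proof -
    consider (one) "q \<le> a" | (two) "a < p" "q \<le> a + b" | (three) "a + b < p"
      | (one_two) "p \<le> a" "a < q" "q \<le> a + b" | (one_three) "p \<le> a" "a + b < q"
      | (two_three) "a < p" "p \<le> a + b" "a + b < q"
      using pq(2) by linarith
    then show ?thesis
    proof cases
      case one
      then show ?thesis using inc1[of p q] pq by simp
    next
      case two
      then have "1 \<le> p - a" "p - a < q - a" "q - a \<le> b" using pq(2) by linarith+
      from inc2[OF this] show ?thesis using two pq by simp
    next
      case three
      then show ?thesis using C3[of p q] pq by simp
    next
      case one_two
      define j where "j = q - a"
      have j: "q = a + j" "1 \<le> j" "j \<le> b" using one_two by (auto simp: j_def)
      have cq: "?c q = j" using j ab by (auto simp: col_of_def)
      show ?thesis
      proof (cases "p = 1")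
        case True
        have "j < u" using inc2'[of u j] u j pq(4) True by (cases "j < u") auto
        then show ?thesis using True cq by (simp add: col_of_def)
      next
        case False
        have "j < b - a + p"
        proof (rule ccontr)
          assume nj: "\<not> j < b - a + p"
          then have "e p \<le> e (a + (b - a) + p)" using C1[of p] pq(1) one_two j by simp
          also have "\<dots> \<le> e (a + j)"
            using inc2'[of "b - a + p" j] nj j pq(1) by (simp add: add.assoc)
          finally show False using pq(4) j by simp
        qed
        then show ?thesis using False cq one_two by (simp add: col_of_def)
      qed
    next
      case one_three
      then have cq: "?c q = u" using ab by (simp add: col_of_def)
      have "p \<noteq> 1" using uk[of q] u(2) pq one_three by auto
      then show ?thesis using cq one_three uba pq(1) by (simp add: col_of_def)
    next
      case two_three
      define j where "j = p - a"
      have j: "p = a + j" "1 \<le> j" "j \<le> b" using two_three by (auto simp: j_def)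
      have c: "?c p = j" "?c q = u" using j ab two_three by (auto simp: col_of_def)
      have "u < j" using inc2'[of j u] uk[of q] j ub pq two_three by (cases "u < j") auto
      then show ?thesis using c by simp
    qed
  qed
  have "Inv e \<subseteq> Inv (w_diag (hook_diagram a b m u))"
  proof (rule subrelI)
    fix p q assume pq: "(p, q) \<in> Inv e"
    note bounds = Inv_bounds[OF perm pq]
    have "e q < e p" using pq by (simp add: Inv_def)
    with key bounds have "?c q < ?c p" by blast
    then show "(p, q) \<in> Inv (w_diag (hook_diagram a b m u))"
      using w_hook_diagram(2)[OF ab uba bounds] bounds(2) by (simp add: Inv_def)
  qed
  then show ?thesis using u(1) uba by blast
qed

text \<open>
  Enlarging \<open>u\<close> moves the first node of the first row behind more nodes of the second row, but it
  moves the nodes below behind more nodes of the second row as well, which removes inversions.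
\<close>

lemma Inv_hook_diagram_antichain:
  assumes ab: "1 \<le> a" "1 \<le> b" and m: "1 \<le> m"
    and u: "1 \<le> u" "u \<le> b - a + 1" and v: "1 \<le> v" "v \<le> b - a + 1"
    and sub: "Inv (w_diag (hook_diagram a b m u)) \<subseteq> Inv (w_diag (hook_diagram a b m v))"
  shows "u = v"
proof -
  have imp: "col_of a b v q < col_of a b v p"
    if "1 \<le> p" "p < q" "q \<le> a + b + m" "col_of a b u q < col_of a b u p" for p q
  proof -
    have "(p, q) \<in> Inv (w_diag (hook_diagram a b m u))"
      using w_hook_diagram(2)[OF ab u(2) that(1-3)] that(2,4) by (simp add: Inv_def)
    then have "(p, q) \<in> Inv (w_diag (hook_diagram a b m v))" using sub by blast
    then show ?thesis
      using w_hook_diagram(2)[OF ab v(2) that(1-3)] by (simp add: Inv_def)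
  qed
  have b: "u \<le> b" "v \<le> b" using u v ab by auto
  have c: "col_of a b x 1 = x" "col_of a b x (a + j) = j" "col_of a b x (a + b + 1) = x"
    if "1 \<le> j" "j \<le> b" for x j
    using that ab by (auto simp: col_of_def)
  have "\<not> v < u"
  proof
    assume vu: "v < u"
    then show False using imp[of 1 "a + v"] c[of v] v b ab by simp
  qed
  moreover have "\<not> u < v"
  proof
    assume uv: "u < v"
    then show False using imp[of "a + v" "a + b + 1"] c[of v] v b ab m by simp
  qed
  ultimately show ?thesis by simp
qed

lemma Y_set_eq:
  assumes ab: "1 \<le> a" "1 \<le> b" and m: "1 \<le> m"
  shows "Y_set (a # b # replicate m 1) =
    {w_diag (hook_diagram a b m u) | u. 1 \<le> u \<and> u \<le> b - a + 1}" (is "Y_set ?lam = ?W")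
proof -
  have n: "sum_list ?lam = a + b + m" by (simp add: sum_list_replicate)
  have perm: "x permutes {1..a + b + m}" if "x \<in> Z_set ?lam" for x
    using that unfolding Z_set_iff[OF ab] by blast
  have prefix: "cox_prefix (sum_list ?lam) x y \<longleftrightarrow> Inv x \<subseteq> Inv y" if "x \<in> Z_set ?lam" "y \<in> Z_set ?lam" for x y
    unfolding n using perm[OF that(1)] perm[OF that(2)] by (rule cox_prefix_iff)
  have WZ: "x \<in> Z_set ?lam" if "x \<in> ?W" for x
    using that w_hook_diagram_in_Z[OF ab] by blast
  have below: "\<exists>x \<in> ?W. Inv e \<subseteq> Inv x" if "e \<in> Z_set ?lam" for e
    using Z_below_hook_diagram[OF ab that] by blast
  have anti: "x = y" if "x \<in> ?W" "y \<in> ?W" "Inv x \<subseteq> Inv y" for x y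
    using that Inv_hook_diagram_antichain[OF ab m] by blast
  show ?thesis
  proof (intro equalityI subsetI)
    fix x assume x: "x \<in> Y_set ?lam"
    then have xZ: "x \<in> Z_set ?lam" by (simp add: Y_set_def)
    obtain y where y: "y \<in> ?W" "Inv x \<subseteq> Inv y" using below[OF xZ] by blast
    then have "y = x" using x prefix[OF xZ WZ[OF y(1)]] WZ[OF y(1)] unfolding Y_set_def by blast
    then show "x \<in> ?W" using y by simp
  next
    fix x assume x: "x \<in> ?W"
    have "\<not> cox_prefix (sum_list ?lam) x y" if y: "y \<in> Z_set ?lam" "y \<noteq> x" for y
    proof
      assume "cox_prefix (sum_list ?lam) x y"
      then have xy: "Inv x \<subseteq> Inv y" using prefix[OF WZ[OF x] y(1)] by blast
      obtain z where z: "z \<in> ?W" "Inv y \<subseteq> Inv z" using below[OF y(1)] by blast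
      then have "x = z" using anti[OF x z(1)] xy by blast
      then have "Inv x = Inv y" using xy z by blast
      then have "x = y" by (rule Inv_inject[OF perm[OF WZ[OF x]] perm[OF y(1)]])
      then show False using y(2) by simp
    qed
    then show "x \<in> Y_set ?lam" using WZ[OF x] by (simp add: Y_set_def)
  qed
qed

lemma E_set_eq:
  assumes "1 \<le> a" "1 \<le> b" "1 \<le> m"
  shows "E_set (a # b # replicate m 1) = {hook_diagram a b m u | u. 1 \<le> u \<and> u \<le> b - a + 1}"
proof -
  have "(\<lambda>y. min_diagram y (a # b # replicate m 1)) ` (\<lambda>u. w_diag (hook_diagram a b m u)) ` {1..b - a + 1}
      = hook_diagram a b m ` {1..b - a + 1}"
    unfolding image_image using min_diagram_hook_diagram[OF assms(1,2)] by (intro image_cong) auto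
  moreover have "{w_diag (hook_diagram a b m u) | u. 1 \<le> u \<and> u \<le> b - a + 1}
      = (\<lambda>u. w_diag (hook_diagram a b m u)) ` {1..b - a + 1}" by auto
  moreover have "{hook_diagram a b m u | u. 1 \<le> u \<and> u \<le> b - a + 1} = hook_diagram a b m ` {1..b - a + 1}"
    by auto
  ultimately show ?thesis unfolding E_set_def Y_set_eq[OF assms] by simp
qed

section \<open>Special diagrams\<close>

lemma V_diagram_eq:
  assumes "b \<le> a" "1 \<le> b"
  shows "V_diagram (a # b # replicate m 1) = hook_diagram a b m 1"
proof -
  have nth: "(a # b # replicate m (1 :: nat)) ! (i - 1) = (if i = 1 then a else if i = 2 then b else 1)"
    if "1 \<le> i" "i \<le> m + 2" for i
    using that by (auto simp: nth_Cons')
  have "V_diagram (a # b # replicate m 1) =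
      {(i, j). 1 \<le> i \<and> i \<le> m + 2 \<and> 1 \<le> j \<and> j \<le> (if i = 1 then a else if i = 2 then b else 1)}"
    unfolding V_diagram_def using nth by fastforce
  also have "\<dots> = hook_diagram a b m 1"
    using assms by (subst hook_diagram_eq) (auto split: if_splits)
  finally show ?thesis .
qed

lemma injection_extends_to_permutation:
  fixes f :: "'a \<Rightarrow> 'a"
  assumes S: "finite S" and A: "A \<subseteq> S" "f ` A \<subseteq> S" "inj_on f A"
  obtains \<tau> where "\<tau> permutes S" "\<And>x. x \<in> A \<Longrightarrow> \<tau> x = f x"
proof -
  have fin: "finite A" using A(1) S by (rule finite_subset)
  have "card (S - A) = card (S - f ` A)"
    using A S fin by (simp add: card_Diff_subset card_image)
  then obtain g where g: "bij_betw g (S - A) (S - f ` A)"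
    using finite_same_card_bij S by blast
  define \<tau> where "\<tau> x = (if x \<in> A then f x else if x \<in> S then g x else x)" for x
  have "bij_betw \<tau> A (f ` A)"
    using A(3) by (subst bij_betw_cong[of _ _ f]) (auto simp: \<tau>_def inj_on_imp_bij_betw)
  moreover have "bij_betw \<tau> (S - A) (S - f ` A)"
    using g by (subst bij_betw_cong[of _ _ g]) (auto simp: \<tau>_def)
  ultimately have "bij_betw \<tau> (A \<union> (S - A)) (f ` A \<union> (S - f ` A))"
    by (rule bij_betw_combine) auto
  then have "bij_betw \<tau> S S" using A by (simp add: Un_absorb1)
  then have "\<tau> permutes S" by (rule bij_imp_permutes) (use A in \<open>auto simp: \<tau>_def\<close>)
  then show ?thesis using that by (simp add: \<tau>_def)
qed

text \<open>
  For \<open>a < b\<close> the first two rows are exchanged, and the first \<open>a\<close> columns of the Young diagram are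
  sent to the columns of the short row.
\<close>

lemma special_hook_diagram:
  assumes ab: "1 \<le> a" "1 \<le> b" and u: "1 \<le> u" "u \<le> b - a + 1"
  shows "special (hook_diagram a b m u)"
proof -
  have diag: "diagram (hook_diagram a b m u)"
    using hook_diagram_in_diagrams_of[OF assms] by (simp add: diagrams_of_def)
  have part: "partition_of (c # d # replicate m 1) (sum_list (c # d # replicate m 1))"
    if "1 \<le> d" "d \<le> c" for c d
    using that by (auto simp: partition_of_def composition_of_def sorted_wrt_iff_nth_less nth_Cons')
  show ?thesis
  proof (cases "b \<le> a")
    case True
    then have "u = 1" using u by simp
    then have "hook_diagram a b m u = V_diagram (a # b # replicate m 1)"
      using V_diagram_eq[OF True ab(2)] by simp
    then have "hook_diagram a b m u = map_prod id id ` V_diagram (a # b # replicate m 1)"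
      unfolding prod.map_id0 image_id by simp
    then show ?thesis
      unfolding special_def using diag part[OF ab(2) True] permutes_id by blast
  next
    case False
    then have "a \<le> b" by simp
    let ?V = "V_diagram (b # a # replicate m 1)"
    have V: "?V = hook_diagram b a m 1" using \<open>a \<le> b\<close> ab(1) by (rule V_diagram_eq)
    have VD: "hook_diagram b a m 1 \<in> diagrams_of (b # a # replicate m 1)"
      using ab by (intro hook_diagram_in_diagrams_of) auto
    have rows: "fst ` ?V = {1..m + 2}"
      using VD unfolding V diagrams_of_def by simp
    have cols: "snd ` ?V = {1..b}"
      unfolding V using columns_hook_diagram[of b a 1 m] ab \<open>a \<le> b\<close> by (simp add: max_def)
    define f where "f j = (if j = 1 then u else b - a + j)" for j
    have "inj_on f {1..a}"
      by (rule linorder_inj_onI) (use u in \<open>auto simp: f_def\<close>)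
    moreover have "f ` {1..a} \<subseteq> {1..b}" using u ab \<open>a \<le> b\<close> by (auto simp: f_def)
    ultimately obtain \<tau> where \<tau>: "\<tau> permutes {1..b}" "\<And>j. j \<in> {1..a} \<Longrightarrow> \<tau> j = f j"
      using \<open>a \<le> b\<close> by (elim injection_extends_to_permutation[of "{1..b}" "{1..a}" f, rotated -1]) auto
    have \<sigma>: "transpose 1 2 permutes {1..m + 2}" by (rule permutes_swap_id) auto
    have times: "map_prod (transpose 1 2) \<tau> ` (A \<times> B) = transpose 1 2 ` A \<times> \<tau> ` B" for A B
      by force
    have "?V = {1} \<times> {1..b} \<union> {2} \<times> {1..a} \<union> {3..m + 2} \<times> {1}"
      unfolding V using ab \<open>a \<le> b\<close> by (subst hook_diagram_eq) auto
    then have "map_prod (transpose 1 2) \<tau> ` ?V =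
        {2} \<times> \<tau> ` {1..b} \<union> {1} \<times> \<tau> ` {1..a} \<union> {3..m + 2} \<times> {\<tau> 1}"
      by (simp only: image_Un times) auto
    also have "\<tau> ` {1..b} = {1..b}" using permutes_image[OF \<tau>(1)] .
    also have "\<tau> ` {1..a} = f ` {1..a}" using \<tau>(2) by (intro image_cong) auto
    also have "f ` {1..a} = {u} \<union> {b - a + i | i. 2 \<le> i \<and> i \<le> a}"
      using ab(1) by (auto simp: f_def image_iff)
    also have "\<tau> 1 = u" using \<tau>(2)[of 1] ab(1) by (simp add: f_def)
    also have "{2} \<times> {1..b} \<union> {1} \<times> ({u} \<union> {b - a + i | i. 2 \<le> i \<and> i \<le> a}) \<union> {3..m + 2} \<times> {u}
        = hook_diagram a b m u"
      unfolding hook_diagram_eq[OF ab] by auto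
    finally have "hook_diagram a b m u = map_prod (transpose 1 2) \<tau> ` ?V" ..
    then show ?thesis
      unfolding special_def
    proof (intro conjI exI)
      show "diagram (hook_diagram a b m u)" by (fact diag)
      show "partition_of (b # a # replicate m 1) (sum_list (b # a # replicate m 1))"
        using ab(1) \<open>a \<le> b\<close> by (rule part)
      show "transpose 1 2 permutes fst ` ?V" "\<tau> permutes snd ` ?V"
        using \<sigma> \<tau>(1) unfolding rows cols .
    qed
  qed
qed

lemma hook_diagram_inject:
  assumes "1 \<le> a" "1 \<le> b" "1 \<le> m" "hook_diagram a b m u = hook_diagram a b m v"
  shows "u = v"
proof -
  have "(3, u) \<in> hook_diagram a b m u" using assms(3) by (auto simp: hook_diagram_eq[OF assms(1,2)])
  then have "(3, u) \<in> hook_diagram a b m v" using assms(4) by simp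
  then show ?thesis by (auto simp: hook_diagram_eq[OF assms(1,2)])
qed

lemma E_special_eq:
  assumes "1 \<le> a" "1 \<le> b" "1 \<le> m"
  shows "E_special (a # b # replicate m 1) = E_set (a # b # replicate m 1)"
  unfolding E_special_def E_set_eq[OF assms] using special_hook_diagram[OF assms(1,2)] by blast

theorem theorem4p3:
  fixes r s t :: nat and lam :: "nat list"
  assumes "r \<ge> 3" and "s \<ge> t" and "t \<ge> 1"
    and "composition_of lam (sum_list lam)" and "length lam = r"
    and "(lam ! 0, lam ! 1) = (s, t) \<or> (lam ! 0, lam ! 1) = (t, s)"
    and "\<forall>i. 2 < i \<and> i \<le> r \<longrightarrow> lam ! (i - 1) = 1"
  shows "((lam ! 0, lam ! 1) = (s, t) \<longrightarrow>
            E_set lam = E_special lam \<and> E_special lam = {V_diagram lam})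
       \<and> ((lam ! 0, lam ! 1) = (t, s) \<longrightarrow>
            E_set lam = {D_tsu r t s u | u. 1 \<le> u \<and> u \<le> s - t + 1}
          \<and> E_set lam = E_special lam
          \<and> card (E_set lam) = s - t + 1)"
proof -
  define m where "m = r - 2"
  have m: "1 \<le> m" "r = m + 2" using assms(1) by (simp_all add: m_def)
  have lam: "lam = lam ! 0 # lam ! 1 # replicate m 1"
  proof (rule nth_equalityI)
    show "length lam = length (lam ! 0 # lam ! 1 # replicate m 1)" using assms(5) m by simp
    fix i assume i: "i < length lam"
    consider "i = 0" | "i = 1" | "2 \<le> i" by linarith
    then show "lam ! i = (lam ! 0 # lam ! 1 # replicate m 1) ! i"
    proof cases
      case 3
      then have "lam ! i = 1" using assms(7)[rule_format, of "Suc i"] i assms(5) by simp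
      then show ?thesis using 3 i assms(5) m by (simp add: nth_Cons')
    qed simp_all
  qed
  have t: "1 \<le> t" "1 \<le> s" using assms(2,3) by simp_all
  have "E_set lam = E_special lam \<and> E_special lam = {V_diagram lam}"
    if "(lam ! 0, lam ! 1) = (s, t)"
  proof -
    have l: "lam = s # t # replicate m 1" using lam that by simp
    have "{hook_diagram s t m u | u. 1 \<le> u \<and> u \<le> t - s + 1} = {hook_diagram s t m 1}"
      using assms(2) by auto
    then show ?thesis
      unfolding l E_special_eq[OF t(2,1) m(1)] E_set_eq[OF t(2,1) m(1)]
        V_diagram_eq[OF assms(2) t(1)] by simp
  qed
  moreover have "E_set lam = {D_tsu r t s u | u. 1 \<le> u \<and> u \<le> s - t + 1}
      \<and> E_set lam = E_special lam \<and> card (E_set lam) = s - t + 1"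
    if "(lam ! 0, lam ! 1) = (t, s)"
  proof -
    have l: "lam = t # s # replicate m 1" using lam that by simp
    have "{(1 :: nat, s - t + i) | i. 2 \<le> i \<and> i \<le> t} = {(1, i) | i. s - t + 2 \<le> i \<and> i \<le> s}"
    proof (intro equalityI subsetI)
      fix z assume "z \<in> {(1 :: nat, i) | i. s - t + 2 \<le> i \<and> i \<le> s}"
      then obtain i where "z = (1, i)" "s - t + 2 \<le> i" "i \<le> s" by blast
      then show "z \<in> {(1, s - t + i) | i. 2 \<le> i \<and> i \<le> t}"
        using assms(2) by (intro CollectI exI[of _ "i - (s - t)"]) auto
    qed (use assms(2) in auto)
    then have D: "hook_diagram t s m u = D_tsu r t s u" for u
      by (simp add: hook_diagram_eq[OF t] D_tsu_def m(2))
    have E: "E_set lam = {D_tsu r t s u | u. 1 \<le> u \<and> u \<le> s - t + 1}"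
      unfolding l E_set_eq[OF t m(1)] D ..
    also have "\<dots> = D_tsu r t s ` {1..s - t + 1}" by auto
    finally have "card (E_set lam) = card (D_tsu r t s ` {1..s - t + 1})" by simp
    also have "\<dots> = card {1..s - t + 1}"
      by (rule card_image) (auto intro!: inj_onI hook_diagram_inject[OF t m(1)] simp: D)
    finally have "card (E_set lam) = s - t + 1" by simp
    then show ?thesis using E E_special_eq[OF t m(1)] unfolding l by simp
  qed
  ultimately show ?thesis by blast
qed

end
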